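(* Let $\alpha\in(0,1)$. For the $\chi^2(2)$ asymptotic null distribution of the statistic $\mathcal{D}_t=T_w\,\bar{\boldsymbol{\xi}}_{\perp,t}^\top\boldsymbol{\Sigma}_{\mathrm{long}}^{-1}\bar{\boldsymbol{\xi}}_{\perp,t}$ (see context), the detection threshold at asymptotic false-alarm rate $\alpha$ is $$D_\alpha=-2\ln\alpha,$$ since $P(\chi^2(2)\ge d)=e^{-d/2}$ for all $d\ge0$. The false-alarm rate satisfies $$P_{H_0}(\mathcal{D}_t\ge D_\alpha)\longrightarrow\alpha\qquad\text{as }T_w\to\infty.$$ Numerically (to three decimals), $D_{0.10}=4.605$, $D_{0.05}=5.991$, $D_{0.01}=9.210$.
   Context: Let $\omega_f,\omega_v>0$, $k_P,k_Q\ge0$, $\sigma>0$ and $\mathbf{A}_\perp=\begin{pmatrix}-\omega_f & k_P\omega_f\\ -k_Q\omega_v & -\omega_v\end{pmatrix}$. Under the null hypothesis $H_0$, $\boldsymbol{\xi}_\perp$ is the stationary Ornstein--Uhlenbeck process $d\boldsymbol{\xi}_\perp=\mathbf{A}_\perp\boldsymbol{\xi}_\perp\,dt+\sigma\,dW_t$ in $\mathbb{R}^2$, with $W_t$ standard 2-dimensional Brownian motion. Its stationary covariance $\boldsymbol{\Sigma}$ is the unique symmetric positive-definite solution of $\mathbf{A}_\perp\boldsymbol{\Sigma}+\boldsymbol{\Sigma}\mathbf{A}_\perp^\top+\sigma^2I_2=0$, and its long-run covariance is $\boldsymbol{\Sigma}_{\mathrm{long}}=\int_{-\infty}^\infty\mathrm{Cov}(\boldsymbol{\xi}_\perp(0),\boldsymbol{\xi}_\perp(\tau))\,d\tau=(-\mathbf{A}_\perp)^{-1}\boldsymbol{\Sigma}+\boldsymbol{\Sigma}(-\mathbf{A}_\perp)^{-\top}$.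 For a window length $T_w>0$, $\bar{\boldsymbol{\xi}}_{\perp,t}=\frac1{T_w}\int_{t-T_w}^t\boldsymbol{\xi}_\perp(s)\,ds$. An alarm is declared when the statistic exceeds the threshold; the false-alarm rate is the probability of this under $H_0$. *)

theory Defs
  imports "HOL-Probability.Probability"
begin

definition chi_squared :: "nat \<Rightarrow> real measure" where
  "chi_squared k =
     distr (\<Pi>\<^sub>M i\<in>{..<k}. density lborel (\<lambda>x. ennreal (std_normal_density x))) borel
       (\<lambda>x. \<Sum>i<k. (x i)\<^sup>2)"

(* The level d at which the upper tail of the law \<mu> has mass \<alpha>.  The description is meaningful
   only where such a d exists and is unique. *)
definition upper_critical_value :: "real measure \<Rightarrow> real \<Rightarrow> real" where
  "upper_critical_value \<mu> \<alpha> = (THE d. measure \<mu> {d..} = \<alpha>)"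

definition strictly_stationary :: "'a measure \<Rightarrow> (real \<Rightarrow> 'a \<Rightarrow> 'b::topological_space) \<Rightarrow> bool" where
  "strictly_stationary M X \<longleftrightarrow>
     (\<forall>h. distr M (\<Pi>\<^sub>M s\<in>UNIV. borel) (\<lambda>\<omega> s. X (s + h) \<omega>)
        = distr M (\<Pi>\<^sub>M s\<in>UNIV. borel) (\<lambda>\<omega> s. X s \<omega>))"

definition covariance_matrix ::
    "'a measure \<Rightarrow> ('a \<Rightarrow> real ^ 'n) \<Rightarrow> ('a \<Rightarrow> real ^ 'm) \<Rightarrow> real ^ 'm ^ 'n" where
  "covariance_matrix M X Y =
     (\<chi> i j. \<integral>\<omega>. (X \<omega> $ i - (\<integral>\<omega>'. X \<omega>' $ i \<partial>M)) * (Y \<omega> $ j - (\<integral>\<omega>'. Y \<omega>' $ j \<partial>M)) \<partial>M)"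

definition long_run_covariance ::
    "'a measure \<Rightarrow> (real \<Rightarrow> 'a \<Rightarrow> real ^ 'n) \<Rightarrow> real ^ 'n ^ 'n" where
  "long_run_covariance M \<xi> = (\<integral>\<tau>. covariance_matrix M (\<xi> 0) (\<xi> \<tau>) \<partial>lborel)"

(* Standard n-dimensional Brownian motion with two-sided time and W 0 = 0, relative to a
   filtration F indexed by all of \<real>.  For negative times W s is minus an increment over [s, 0] and
   hence not F s-measurable, so it is the forward increments that are adapted to F and
   independent of the past.  In particular increments over disjoint intervals are independent. *)
locale two_sided_brownian_motion = prob_space M + filtration "space M" F
  for M :: "'a measure" and F :: "real \<Rightarrow> 'a measure" +
  fixes W :: "real \<Rightarrow> 'a \<Rightarrow> real ^ 'n"
  assumes subalgebra_F: "\<And>s. subalgebra M (F s)"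
    and W_measurable: "\<And>s. W s \<in> borel_measurable M"
    and W_zero: "AE \<omega> in M. W 0 \<omega> = 0"
    and W_continuous: "\<And>\<omega>. \<omega> \<in> space M \<Longrightarrow> continuous_on UNIV (\<lambda>s. W s \<omega>)"
    and W_increment_adapted:
      "\<And>s u. s < u \<Longrightarrow> (\<lambda>\<omega>. W u \<omega> - W s \<omega>) \<in> borel_measurable (F u)"
    and W_increment_normal:
      "\<And>s u. s < u \<Longrightarrow>
         distributed M lborel (\<lambda>\<omega>. W u \<omega> - W s \<omega>)
           (\<lambda>x. \<Prod>i\<in>UNIV. ennreal (normal_density 0 (sqrt (u - s)) (x $ i)))"
    and W_increment_indep:
      "\<And>s u. s < u \<Longrightarrow>
         indep_set (sets (F s)) (sets (vimage_algebra (space M) (\<lambda>\<omega>. W u \<omega> - W s \<omega>) borel))"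

(* Stationary solution on the whole time axis of d\<xi> = A \<xi> dt + \<sigma> dW.  The noise being additive, the
   stochastic integral of \<sigma> over [s, u] is \<sigma> (W u - W s). *)
locale stationary_ou_process = two_sided_brownian_motion M F W
  for M :: "'a measure" and F :: "real \<Rightarrow> 'a measure" and W :: "real \<Rightarrow> 'a \<Rightarrow> real ^ 'n" +
  fixes A :: "real ^ 'n ^ 'n" and \<sigma> :: real and \<xi> :: "real \<Rightarrow> 'a \<Rightarrow> real ^ 'n"
  assumes \<xi>_adapted: "\<And>s. \<xi> s \<in> borel_measurable (F s)"
    and \<xi>_continuous: "\<And>\<omega>. \<omega> \<in> space M \<Longrightarrow> continuous_on UNIV (\<lambda>s. \<xi> s \<omega>)"
    and \<xi>_sde:
      "AE \<omega> in M. \<forall>s u. s \<le> u \<longrightarrow>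
         \<xi> u \<omega> - \<xi> s \<omega> = integral {s..u} (\<lambda>r. A *v \<xi> r \<omega>) + \<sigma> *\<^sub>R (W u \<omega> - W s \<omega>)"
    and \<xi>_stationary: "strictly_stationary M \<xi>"

definition A_perp :: "real \<Rightarrow> real \<Rightarrow> real \<Rightarrow> real \<Rightarrow> real ^ 2 ^ 2" where
  "A_perp \<omega>\<^sub>f \<omega>\<^sub>v k\<^sub>P k\<^sub>Q = vector [vector [- \<omega>\<^sub>f, k\<^sub>P * \<omega>\<^sub>f], vector [- k\<^sub>Q * \<omega>\<^sub>v, - \<omega>\<^sub>v]]"

definition window_mean :: "(real \<Rightarrow> 'a \<Rightarrow> real ^ 'n) \<Rightarrow> real \<Rightarrow> real \<Rightarrow> 'a \<Rightarrow> real ^ 'n" where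
  "window_mean \<xi> T t \<omega> = (1 / T) *\<^sub>R integral {t - T..t} (\<lambda>s. \<xi> s \<omega>)"

definition detection_statistic ::
    "'a measure \<Rightarrow> (real \<Rightarrow> 'a \<Rightarrow> real ^ 'n) \<Rightarrow> real \<Rightarrow> real \<Rightarrow> 'a \<Rightarrow> real" where
  "detection_statistic M \<xi> T t \<omega> =
     T * (window_mean \<xi> T t \<omega> \<bullet> (matrix_inv (long_run_covariance M \<xi>) *v window_mean \<xi> T t \<omega>))"

definition detection_threshold :: "real \<Rightarrow> real" where
  "detection_threshold \<alpha> = upper_critical_value (chi_squared 2) \<alpha>"

end

theory Submission
  imports Defs "HOL-Real_Asymp.Real_Asymp"
begin

text \<open>
  Integrating the equation over the window gives
  \<open>A \<integral> \<xi> = \<xi>\<^sub>t - \<xi>\<^bsub>t-T\<^esub> - \<sigma> (W\<^sub>t - W\<^bsub>t-T\<^esub>)\<close>, and the long-run covariance is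
  \<open>\<sigma>\<^sup>2 A\<^sup>-\<^sup>1 A\<^sup>-\<^sup>T\<close>, so that the statistic equals
  \<open>|\<xi>\<^sub>t - \<xi>\<^bsub>t-T\<^esub> - \<sigma> (W\<^sub>t - W\<^bsub>t-T\<^esub>)|\<^sup>2 / (T \<sigma>\<^sup>2)\<close>. The Brownian part has exactly the chi-squared law
  for every \<open>T\<close>, while the boundary terms are bounded in mean square and vanish after division by
  \<open>T\<close>; normality of \<open>\<xi>\<close> itself is never needed. Finite second moments come from a quadratic
  Lyapunov form, which makes the process contract over long time steps up to an error with
  bounded expectation. The long-run covariance follows from linear integral equations for
  \<open>E (\<xi>\<^sub>0 \<xi>\<^sub>\<tau>\<^sup>T)\<close> and \<open>E (\<xi>\<^sub>\<tau> W\<^sub>\<tau>\<^sup>T)\<close>, whose solutions converge exponentially by the same form.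
\<close>

section \<open>Quadratic Lyapunov forms\<close>

text \<open>The process is assumed to have neither a Gaussian law nor finite moments. Yet
  \<open>long_run_covariance\<close> is a Bochner integral of expectations, and each of these takes
  the default value 0 where it does not exist; so square integrability of \<open>\<xi>\<close> and
  integrability over all lags have to be proved before the matrix in the statistic means anything.
  Matrix exponentials and Ito calculus are avoided: the noise is additive, so \<open>\<xi>\<close>
  minus its noise since a fixed time is a differentiable path solving a forced linear equation, and
  deterministic estimates apply path by path. Likewise the Lyapunov equation for the stationary
  covariance is never solved; the product of \<open>A\<close>, the long-run covariance and
  \<open>transpose A\<close> is obtained directly as a limit. The boundary terms may depend on the
  Brownian increment of the same window. Smallness in probability copes with this, provided that
  norms are compared before squaring, where the triangle inequality gives an additive error without
  a cross term.\<close>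

locale lyapunov_form =
  fixes A P :: "real ^ 'n ^ 'n" and \<kappa> K c :: real
  assumes P_sym: "transpose P = P"
    and \<kappa>_pos: "\<kappa> > 0" and c_pos: "c > 0" and K_nonneg: "K \<ge> 0"
    and P_lower: "\<And>x. \<kappa> * (norm x)\<^sup>2 \<le> x \<bullet> (P *v x)"
    and P_upper: "\<And>x. x \<bullet> (P *v x) \<le> K * (norm x)\<^sup>2"
    and P_dissipative: "\<And>x. x \<bullet> (P *v (A *v x)) \<le> - c * (x \<bullet> (P *v x))"
begin

lemma P_swap: "x \<bullet> (P *v y) = y \<bullet> (P *v x)"
  by (metis P_sym dot_lmul_matrix inner_commute vector_transpose_matrix)

text \<open>Positivity of the form at \<open>c y - g\<close>. Of the decay rate 2 c that
  dissipativity gives along y' = A y, this spends one c on the forcing term, which is why the rate c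
  remains in \<open>forced_decay\<close>.\<close>

lemma lyapunov_young: "2 * (y \<bullet> (P *v g)) \<le> c * (y \<bullet> (P *v y)) + K / c * (norm g)\<^sup>2"
proof -
  define z where "z = c *\<^sub>R y - g"
  have "0 \<le> z \<bullet> (P *v z)"
    using P_lower[of z] \<kappa>_pos by (meson order_trans zero_le_mult_iff less_imp_le zero_le_power2)
  also have "z \<bullet> (P *v z) = c\<^sup>2 * (y \<bullet> (P *v y)) - 2 * c * (y \<bullet> (P *v g)) + g \<bullet> (P *v g)"
    by (simp add: z_def matrix_vector_mult_diff_distrib inner_diff_left inner_diff_right
        matrix_vector_mult_scaleR P_swap[of g y] power2_eq_square algebra_simps)
  finally have "2 * c * (y \<bullet> (P *v g)) \<le> c\<^sup>2 * (y \<bullet> (P *v y)) + K * (norm g)\<^sup>2"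
    using P_upper[of g] by linarith
  then have "c * (2 * (y \<bullet> (P *v g))) \<le> c * (c * (y \<bullet> (P *v y)) + K / c * (norm g)\<^sup>2)"
    using c_pos by (simp add: power2_eq_square distrib_left ac_simps)
  then show ?thesis using c_pos by (simp only: mult_le_cancel_left_pos)
qed

text \<open>Gronwall's argument with the integrating factor exp(c t): \<open>f\<close> is
  nonincreasing. The weight inside the forcing integral is then bounded by its value at the right
  end, which is crude but enough for a time step of fixed length.\<close>

lemma forced_decay:
  assumes ab: "a \<le> b"
    and y: "\<And>t. t \<in> {a..b} \<Longrightarrow> (y has_vector_derivative A *v y t + g t) (at t within {a..b})"
    and g: "continuous_on {a..b} g"
  shows "\<kappa> * (norm (y b))\<^sup>2 \<le>
    exp (- c * (b - a)) * K * (norm (y a))\<^sup>2 + K / c * integral {a..b} (\<lambda>r. (norm (g r))\<^sup>2)"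
proof -
  let ?V = "\<lambda>t. y t \<bullet> (P *v y t)"
  let ?k = "\<lambda>r. exp (c * r) * (norm (g r))\<^sup>2"
  define f where "f t = exp (c * t) * ?V t - K / c * integral {a..t} ?k" for t
  have k_cont: "continuous_on {a..b} ?k" by (intro continuous_intros g)
  have V': "(?V has_real_derivative 2 * (y t \<bullet> (P *v (A *v y t + g t)))) (at t within {a..b})"
    if "t \<in> {a..b}" for t
  proof -
    have 1: "((\<lambda>t. P *v y t) has_vector_derivative P *v (A *v y t + g t)) (at t within {a..b})"
      by (rule bounded_linear.has_vector_derivative[OF _ y[OF that]])
         (simp add: linear_conv_bounded_linear[symmetric])
    have "(?V has_vector_derivative y t \<bullet> (P *v (A *v y t + g t)) + (A *v y t + g t) \<bullet> (P *v y t))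
        (at t within {a..b})"
      by (rule bounded_bilinear.has_vector_derivative[OF bounded_bilinear_inner y[OF that] 1])
    then show ?thesis
      by (simp add: has_real_derivative_iff_has_vector_derivative P_swap[of "A *v y t + g t" "y t"])
  qed
  have f': "(f has_real_derivative exp (c * t) * (c * ?V t + 2 * (y t \<bullet> (P *v (A *v y t + g t)))
      - K / c * (norm (g t))\<^sup>2)) (at t within {a..b})" if "t \<in> {a..b}" for t
  proof -
    have I: "((\<lambda>t. integral {a..t} ?k) has_real_derivative ?k t) (at t within {a..b})"
      using integral_has_vector_derivative[OF k_cont that]
      by (simp add: has_real_derivative_iff_has_vector_derivative)
    have E: "((\<lambda>t. exp (c * t)) has_real_derivative c * exp (c * t)) (at t within {a..b})"
      by (auto intro!: derivative_eq_intros)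
    have "(f has_real_derivative (c * exp (c * t) * ?V t + (2 * (y t \<bullet> (P *v (A *v y t + g t)))) * exp (c * t))
        - K / c * ?k t) (at t within {a..b})"
      unfolding f_def by (intro DERIV_diff DERIV_cmult DERIV_mult E V'[OF that] I)
    then show ?thesis by (simp add: algebra_simps)
  qed
  have "f b \<le> f a"
  proof (rule DERIV_nonpos_imp_decreasing_open[OF ab])
    fix t assume t: "a < t" "t < b"
    have "2 * (y t \<bullet> (P *v (A *v y t + g t))) \<le> - c * ?V t + K / c * (norm (g t))\<^sup>2"
      using lyapunov_young[of "y t" "g t"] P_dissipative[of "y t"]
      by (simp add: matrix_vector_right_distrib inner_add_right)
    then have "exp (c * t) * (c * ?V t + 2 * (y t \<bullet> (P *v (A *v y t + g t)))
      - K / c * (norm (g t))\<^sup>2) \<le> 0"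
      by (intro mult_nonneg_nonpos) auto
    moreover have "at t within {a..b} = at t"
      using t by (intro at_within_interior) auto
    ultimately show "\<exists>d. DERIV f t :> d \<and> d \<le> 0"
      using f'[of t] t by (metis atLeastAtMost_iff less_imp_le)
  next
    show "continuous_on {a..b} f"
      using f' by (meson DERIV_continuous continuous_on_eq_continuous_within)
  qed
  then have "exp (c * b) * ?V b \<le> exp (c * a) * ?V a + K / c * integral {a..b} ?k"
    by (simp add: f_def)
  also have "integral {a..b} ?k \<le> integral {a..b} (\<lambda>r. exp (c * b) * (norm (g r))\<^sup>2)"
    using c_pos by (intro integral_le integrable_continuous_interval k_cont continuous_intros g)
      (auto intro!: mult_right_mono)
  also have "\<dots> = exp (c * b) * integral {a..b} (\<lambda>r. (norm (g r))\<^sup>2)" by simp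
  finally have "exp (c * b) * ?V b \<le>
      exp (c * a) * ?V a + K / c * (exp (c * b) * integral {a..b} (\<lambda>r. (norm (g r))\<^sup>2))"
    using c_pos K_nonneg by (simp add: mult_left_mono divide_right_mono)
  also have "\<dots> = exp (c * b) *
      (exp (- c * (b - a)) * ?V a + K / c * integral {a..b} (\<lambda>r. (norm (g r))\<^sup>2))"
  proof -
    have "exp (c * a) = exp (c * b) * exp (- c * (b - a))"
      by (simp add: algebra_simps flip: exp_add)
    then show ?thesis by (simp only: distrib_left mult.assoc mult.left_commute)
  qed
  finally have "?V b \<le> exp (- c * (b - a)) * ?V a + K / c * integral {a..b} (\<lambda>r. (norm (g r))\<^sup>2)"
    by simp
  moreover have "exp (- c * (b - a)) * ?V a \<le> exp (- c * (b - a)) * (K * (norm (y a))\<^sup>2)"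
    by (intro mult_left_mono P_upper) simp
  ultimately show ?thesis using P_lower[of "y b"] unfolding mult.assoc by linarith
qed

lemma flow_decay:
  assumes "0 \<le> T"
    and y: "\<And>t. 0 \<le> t \<Longrightarrow> t \<le> T \<Longrightarrow> (y has_vector_derivative A *v y t) (at t within {0..T})"
  shows "norm (y T) \<le> sqrt (K / \<kappa>) * norm (y 0) * exp (- (c / 2) * T)"
proof -
  have "\<kappa> * (norm (y T))\<^sup>2 \<le> exp (- c * T) * K * (norm (y 0))\<^sup>2"
    using forced_decay[of 0 T y "\<lambda>_. 0"] assms by simp
  then have "(norm (y T))\<^sup>2 \<le> (K / \<kappa>) * (norm (y 0))\<^sup>2 * exp (- c * T)"
    using \<kappa>_pos by (simp add: field_simps)
  also have "\<dots> = (sqrt (K / \<kappa>) * norm (y 0) * exp (- (c / 2) * T))\<^sup>2"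
  proof -
    have "exp (- c * T) = (exp (- (c / 2) * T))\<^sup>2"
      using exp_double[of "- (c / 2) * T"] by simp
    then show ?thesis using \<kappa>_pos K_nonneg by (simp only: power_mult_distrib real_sqrt_pow2 zero_le_divide_iff) simp
  qed
  finally show ?thesis
    by (rule power2_le_imp_le) (use \<kappa>_pos K_nonneg in auto)
qed

text \<open>The covariance functions to which this is applied are known only through integral
  equations. Continuity makes the right-hand side differentiable by the fundamental theorem, so that
  the differential version applies.\<close>

lemma flow_integral_decay:
  assumes x: "\<And>t. 0 \<le> t \<Longrightarrow> x t = x 0 + integral {0..t} (\<lambda>r. A *v x r)"
    and cont: "continuous_on {0..} x" and T: "0 \<le> T"
  shows "norm (x T) \<le> sqrt (K / \<kappa>) * norm (x 0) * exp (- (c / 2) * T)"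
proof (rule flow_decay[OF T])
  fix t assume t: "0 \<le> t" "t \<le> T"
  have "continuous_on {0..T} (\<lambda>r. A *v x r)"
    by (intro continuous_intros bounded_linear.continuous_on[OF matrix_vector_mul_bounded_linear]
        continuous_on_subset[OF cont]) auto
  then have "((\<lambda>t. x 0 + integral {0..t} (\<lambda>r. A *v x r)) has_vector_derivative A *v x t)
      (at t within {0..T})"
    using integral_has_vector_derivative[of 0 T "\<lambda>r. A *v x r" t] t
    by (auto intro!: derivative_eq_intros)
  then show "(x has_vector_derivative A *v x t) (at t within {0..T})"
    by (rule has_vector_derivative_transform[rotated 2]) (use t in simp, rule x, simp)
qed

end

section \<open>Path integrals of continuous processes\<close>

text \<open>Joint measurability, as Fubini requires it. Rounding time down to a grid leaves
  countably many measurable variables, and path continuity recovers \<open>X\<close> as the grid is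
  refined.\<close>

lemma borel_measurable_continuous_paths:
  fixes X :: "real \<Rightarrow> 'a \<Rightarrow> 'b::euclidean_space"
  assumes X [measurable]: "\<And>s. X s \<in> borel_measurable M"
    and cont: "\<And>\<omega>. \<omega> \<in> space M \<Longrightarrow> continuous_on UNIV (\<lambda>s. X s \<omega>)"
  shows "(\<lambda>p. X (fst p) (snd p)) \<in> borel_measurable (lborel \<Otimes>\<^sub>M M)"
proof (rule borel_measurable_LIMSEQ_metric)
  let ?g = "\<lambda>n s. real_of_int \<lfloor>s * real (Suc n)\<rfloor> / real (Suc n)"
  show "(\<lambda>p. X (?g n (fst p)) (snd p)) \<in> borel_measurable (lborel \<Otimes>\<^sub>M M)" for n
    by (rule measurable_compose_countable[where f = "\<lambda>i p. X (real_of_int i / real (Suc n)) (snd p)"])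
       measurable
  fix p :: "real \<times> 'a" assume "p \<in> space (lborel \<Otimes>\<^sub>M M)"
  then have "continuous_on UNIV (\<lambda>s. X s (snd p))"
    by (intro cont) (auto simp: space_pair_measure)
  moreover have "(\<lambda>n. ?g n (fst p)) \<longlonglongrightarrow> fst p"
  proof (rule tendsto_sandwich)
    show "\<forall>\<^sub>F n in sequentially. fst p - 1 / real (Suc n) \<le> ?g n (fst p)"
    proof (intro always_eventually allI)
      fix n
      have "(fst p * real (Suc n) - 1) / real (Suc n) \<le> ?g n (fst p)"
        by (intro divide_right_mono) linarith+
      then show "fst p - 1 / real (Suc n) \<le> ?g n (fst p)" by (simp add: diff_divide_distrib)
    qed
    show "\<forall>\<^sub>F n in sequentially. ?g n (fst p) \<le> fst p"
      by (intro always_eventually allI) (simp add: divide_le_eq mult.commute)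
    show "(\<lambda>n. fst p - 1 / real (Suc n)) \<longlonglongrightarrow> fst p"
      by real_asymp
  qed auto
  ultimately show "(\<lambda>n. X (?g n (fst p)) (snd p)) \<longlonglongrightarrow> X (fst p) (snd p)"
    using continuous_on_tendsto_compose[of UNIV "\<lambda>s. X s (snd p)"] by auto
qed

lemma integral_path_eq_lborel:
  fixes x :: "real \<Rightarrow> 'b::euclidean_space"
  assumes "continuous_on UNIV x"
  shows "integral {a..b} x = (\<integral>s. indicator {a..b} s *\<^sub>R x s \<partial>lborel)"
proof -
  have "set_integrable lborel {a..b} x"
    using assms by (intro borel_integrable_atLeastAtMost') (auto intro: continuous_on_subset)
  from set_borel_integral_eq_integral(2)[OF this] show ?thesis
    by (simp add: set_lebesgue_integral_def)
qed

lemma borel_measurable_path_integral: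
  fixes X :: "real \<Rightarrow> 'a \<Rightarrow> 'b::euclidean_space"
  assumes X: "\<And>s. X s \<in> borel_measurable M"
    and cont: "\<And>\<omega>. \<omega> \<in> space M \<Longrightarrow> continuous_on UNIV (\<lambda>s. X s \<omega>)"
  shows "(\<lambda>\<omega>. integral {a..b} (\<lambda>s. X s \<omega>)) \<in> borel_measurable M"
proof -
  note [measurable] = borel_measurable_continuous_paths[OF X cont]
  have "(\<lambda>p. X (snd p) (fst p)) \<in> borel_measurable (M \<Otimes>\<^sub>M lborel)"
    using measurable_compose[OF measurable_pair_swap' borel_measurable_continuous_paths[OF X cont]]
    by (simp add: case_prod_unfold)
  then have "(\<lambda>(\<omega>, s). indicator {a..b} s *\<^sub>R X s \<omega>) \<in> borel_measurable (M \<Otimes>\<^sub>M lborel)"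
    by (auto simp: case_prod_unfold)
  then have "(\<lambda>\<omega>. \<integral>s. indicator {a..b} s *\<^sub>R X s \<omega> \<partial>lborel) \<in> borel_measurable M"
    by (rule lborel.borel_measurable_lebesgue_integral)
  then show ?thesis
    by (subst measurable_cong[OF integral_path_eq_lborel[OF cont]])
qed

text \<open>Fubini on a finite window, where a uniform bound on the first absolute moments gives
  integrability. That the moment function itself can be integrated comes out of Fubini as well,
  before anything is known about its continuity.\<close>

lemma (in prob_space) expectation_path_integral:
  fixes X :: "real \<Rightarrow> 'a \<Rightarrow> real"
  assumes X: "\<And>s. X s \<in> borel_measurable M"
    and cont: "\<And>\<omega>. \<omega> \<in> space M \<Longrightarrow> continuous_on UNIV (\<lambda>s. X s \<omega>)"
    and int: "\<And>s. s \<in> {a..b} \<Longrightarrow> integrable M (X s)"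
    and bound: "\<And>s. s \<in> {a..b} \<Longrightarrow> expectation (\<lambda>\<omega>. \<bar>X s \<omega>\<bar>) \<le> B"
  shows integrable_path_integral: "integrable M (\<lambda>\<omega>. integral {a..b} (\<lambda>s. X s \<omega>))"
    and integrable_on_expectation: "(\<lambda>s. expectation (X s)) integrable_on {a..b}"
    and "expectation (\<lambda>\<omega>. integral {a..b} (\<lambda>s. X s \<omega>)) = integral {a..b} (\<lambda>s. expectation (X s))"
proof -
  interpret P: pair_sigma_finite lborel M ..
  let ?f = "\<lambda>p. indicator {a..b} (fst p) * X (fst p) (snd p)"
  note [measurable] = X borel_measurable_continuous_paths[OF X cont]
  have meas: "?f \<in> borel_measurable (lborel \<Otimes>\<^sub>M M)" by measurable
  have meas1: "(\<lambda>s. \<integral>\<omega>. norm (?f (s, \<omega>)) \<partial>M) \<in> borel_measurable lborel"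
    by (rule borel_measurable_lebesgue_integral) (use meas in measurable)
  have f_int: "integrable (lborel \<Otimes>\<^sub>M M) ?f"
  proof (rule P.Fubini_integrable[OF meas])
    show "integrable lborel (\<lambda>s. \<integral>\<omega>. norm (?f (s, \<omega>)) \<partial>M)"
    proof (rule Bochner_Integration.integrable_bound[OF _ meas1])
      show "integrable lborel (\<lambda>s. indicator {a..b} s * B)"
        by (intro integrable_mult_left integrable_real_indicator) (auto simp: emeasure_lborel_Icc_eq)
      show "AE s in lborel. norm (\<integral>\<omega>. norm (?f (s, \<omega>)) \<partial>M) \<le> norm (indicator {a..b} s * B)"
        using bound by (auto simp: indicator_def abs_of_nonneg intro!: AE_I2 order_trans[OF _ abs_ge_self])
    qed
    show "AE s in lborel. integrable M (\<lambda>\<omega>. ?f (s, \<omega>))"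
      using int by (auto simp: indicator_def intro!: AE_I2)
  qed
  then have f_int': "integrable (lborel \<Otimes>\<^sub>M M) (case_prod (\<lambda>s \<omega>. indicator {a..b} s * X s \<omega>))"
    by (simp add: case_prod_unfold)
  have path: "integral {a..b} (\<lambda>s. X s \<omega>) = (\<integral>s. indicator {a..b} s * X s \<omega> \<partial>lborel)"
    if "\<omega> \<in> space M" for \<omega>
    using integral_path_eq_lborel[OF cont[OF that]] by simp
  show "integrable M (\<lambda>\<omega>. integral {a..b} (\<lambda>s. X s \<omega>))"
    using P.integrable_snd[OF f_int'] by (subst Bochner_Integration.integrable_cong[OF refl path])
  have expectation_int: "set_integrable lborel {a..b} (\<lambda>s. expectation (X s))"
    using P.integrable_fst'[OF f_int] by (simp add: set_integrable_def)
  then show "(\<lambda>s. expectation (X s)) integrable_on {a..b}"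
    by (rule set_borel_integral_eq_integral(1))
  have "expectation (\<lambda>\<omega>. integral {a..b} (\<lambda>s. X s \<omega>)) =
      (\<integral>\<omega>. (\<integral>s. indicator {a..b} s * X s \<omega> \<partial>lborel) \<partial>M)"
    by (rule Bochner_Integration.integral_cong[OF refl path])
  also have "\<dots> = (\<integral>s. (\<integral>\<omega>. indicator {a..b} s * X s \<omega> \<partial>M) \<partial>lborel)"
    by (rule P.Fubini_integral[OF f_int'])
  also have "\<dots> = (LINT s:{a..b}|lborel. expectation (X s))"
    by (simp add: set_lebesgue_integral_def)
  also have "\<dots> = integral {a..b} (\<lambda>s. expectation (X s))"
    by (rule set_borel_integral_eq_integral(2)[OF expectation_int])
  finally show "expectation (\<lambda>\<omega>. integral {a..b} (\<lambda>s. X s \<omega>)) =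
      integral {a..b} (\<lambda>s. expectation (X s))" .
qed

text \<open>The elementary |x y| <= x^2 + y^2 stands in for Cauchy-Schwarz; the bound only has to be
  uniform in time, not sharp.\<close>

lemma integrable_mult_of_squares:
  fixes X Y :: "'a \<Rightarrow> real"
  assumes [measurable]: "X \<in> borel_measurable M" "Y \<in> borel_measurable M"
    and "integrable M (\<lambda>\<omega>. (X \<omega>)\<^sup>2)" "integrable M (\<lambda>\<omega>. (Y \<omega>)\<^sup>2)"
  shows "integrable M (\<lambda>\<omega>. X \<omega> * Y \<omega>)"
    and "(\<integral>\<omega>. \<bar>X \<omega> * Y \<omega>\<bar> \<partial>M) \<le> (\<integral>\<omega>. (X \<omega>)\<^sup>2 \<partial>M) + (\<integral>\<omega>. (Y \<omega>)\<^sup>2 \<partial>M)"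
proof -
  have le: "\<bar>x * y\<bar> \<le> x\<^sup>2 + y\<^sup>2" for x y :: real
  proof -
    have "2 * (\<bar>x\<bar> * \<bar>y\<bar>) \<le> x\<^sup>2 + y\<^sup>2" using sum_squares_bound[of "\<bar>x\<bar>" "\<bar>y\<bar>"] by simp
    moreover have "0 \<le> \<bar>x\<bar> * \<bar>y\<bar>" by simp
    ultimately show ?thesis unfolding abs_mult by linarith
  qed
  have sum: "integrable M (\<lambda>\<omega>. (X \<omega>)\<^sup>2 + (Y \<omega>)\<^sup>2)" using assms by simp
  show int: "integrable M (\<lambda>\<omega>. X \<omega> * Y \<omega>)"
    by (rule Bochner_Integration.integrable_bound[OF sum]) (auto intro!: AE_I2 le order_trans[OF _ abs_ge_self])
  have "(\<integral>\<omega>. \<bar>X \<omega> * Y \<omega>\<bar> \<partial>M) \<le> (\<integral>\<omega>. (X \<omega>)\<^sup>2 + (Y \<omega>)\<^sup>2 \<partial>M)"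
    using int sum by (intro integral_mono le) auto
  then show "(\<integral>\<omega>. \<bar>X \<omega> * Y \<omega>\<bar> \<partial>M) \<le> (\<integral>\<omega>. (X \<omega>)\<^sup>2 \<partial>M) + (\<integral>\<omega>. (Y \<omega>)\<^sup>2 \<partial>M)"
    using assms by simp
qed

lemma integrable_vecI:
  fixes f :: "'a \<Rightarrow> 'b::euclidean_space ^ 'n"
  assumes "\<And>i. integrable M (\<lambda>x. f x $ i)"
  shows "integrable M f"
proof -
  have bl: "bounded_linear (axis i :: 'b \<Rightarrow> 'b ^ 'n)" for i
    by (intro linear_conv_bounded_linear[THEN iffD1] linearI) (auto simp: axis_def vec_eq_iff)
  have "integrable M (\<lambda>x. \<Sum>i\<in>UNIV. axis i (f x $ i))"
    by (intro Bochner_Integration.integrable_sum integrable_bounded_linear[OF bl] assms)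
  also have "(\<lambda>x. \<Sum>i\<in>UNIV. axis i (f x $ i)) = f"
    by (simp add: fun_eq_iff vec_eq_iff axis_def if_distrib[of "\<lambda>z. z $ _"] cong: if_cong)
  finally show ?thesis .
qed

lemma integral_vec_nth:
  fixes f :: "'a \<Rightarrow> 'b::euclidean_space ^ 'n"
  assumes "integrable M f"
  shows "(\<integral>x. f x \<partial>M) $ i = (\<integral>x. f x $ i \<partial>M)"
  using integral_bounded_linear[OF bounded_linear_vec_nth assms] by simp

lemma tendsto_integral_Icc_at_top:
  fixes f :: "real \<Rightarrow> 'b::euclidean_space"
  assumes "set_integrable lborel {a..} f"
  shows "((\<lambda>T. integral {a..T} f) \<longlongrightarrow> (LINT x:{a..}|lborel. f x)) at_top"
proof -
  have "((\<lambda>T. LINT x:{a..T}|lborel. f x) \<longlongrightarrow> (LINT x:{a..}|lborel. f x)) at_top"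
    by (rule tendsto_set_lebesgue_integral_at_top[OF _ assms]) auto
  moreover have "(LINT x:{a..T}|lborel. f x) = integral {a..T} f" for T
    by (rule set_borel_integral_eq_integral) (rule set_integrable_subset[OF assms], auto)
  ultimately show ?thesis by simp
qed

section \<open>Exponential decay of the linear flow\<close>

context lyapunov_form
begin

text \<open>A vector in the kernel would be a rest point of the flow, along which a positive form
  cannot decay.\<close>

lemma A_injective: "A *v x = 0 \<Longrightarrow> x = 0"
proof -
  assume "A *v x = 0"
  then have "c * (x \<bullet> (P *v x)) \<le> 0" using P_dissipative[of x] by simp
  then have "x \<bullet> (P *v x) \<le> 0" using c_pos by (simp add: mult_le_0_iff)
  then have "\<kappa> * (norm x)\<^sup>2 \<le> 0" using P_lower[of x] by linarith
  then show "x = 0" using \<kappa>_pos by (simp add: mult_le_0_iff)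
qed

lemma A_invertible: "invertible A"
  using A_injective by (simp add: invertible_left_inverse matrix_left_invertible_ker)

text \<open>The half-line integral of a solution is found without a formula for the flow:
  integrating up to T gives A times the integral over [0, T] as x T - x 0, and x T vanishes at
  infinity.\<close>

lemma flow_exp_bound:
  fixes x :: "real \<Rightarrow> real ^ 'n"
  assumes x: "\<And>t. 0 \<le> t \<Longrightarrow> x t = x 0 + integral {0..t} (\<lambda>r. A *v x r)"
    and cont: "continuous_on {0..} x"
  shows flow_tendsto_0: "(x \<longlongrightarrow> 0) at_top"
    and flow_set_integrable: "set_integrable lborel {0..} x"
    and flow_integral: "A *v (LINT t:{0..}|lborel. x t) = - x 0"
proof -
  let ?k = "sqrt (K / \<kappa>) * norm (x 0)"
  have bound: "norm (x t) \<le> ?k * exp (- (c / 2) * t)" if "0 \<le> t" for t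
    by (rule flow_integral_decay[OF x cont that])
  show lim: "(x \<longlongrightarrow> 0) at_top"
  proof (rule Lim_null_comparison)
    show "\<forall>\<^sub>F t in at_top. norm (x t) \<le> ?k * exp (- (c / 2) * t)"
      using eventually_ge_at_top[of 0] by eventually_elim (rule bound)
    show "((\<lambda>t. ?k * exp (- (c / 2) * t)) \<longlongrightarrow> 0) at_top"
      using c_pos by real_asymp
  qed
  show int: "set_integrable lborel {0..} x"
    unfolding set_integrable_def
  proof (rule Bochner_Integration.integrable_bound)
    show "integrable lborel (\<lambda>t. ?k * (indicator {0<..} t *\<^sub>R exp (- (t * (c / 2)))))"
      using integrable_I0i_exp_mscale[of "c / 2"] c_pos by (simp add: set_integrable_def)
    show "(\<lambda>t. indicator {0..} t *\<^sub>R x t) \<in> borel_measurable lborel"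
      using borel_measurable_continuous_on_indicator[OF _ cont] by simp
    show "AE t in lborel. norm (indicator {0..} t *\<^sub>R x t) \<le>
        norm (?k * (indicator {0<..} t *\<^sub>R exp (- (t * (c / 2)))))"
      \<comment> \<open>The dominating function lives on the open half-line, so the point 0 is
        discarded as a null set.\<close>
      using AE_lborel_singleton[of "0::real"]
    proof eventually_elim
      case (elim t)
      then show ?case
        using order_trans[OF bound[of t] abs_ge_self]
        by (cases "0 < t") (simp_all add: indicator_def mult.commute)
    qed
  qed
  have "((\<lambda>T. A *v integral {0..T} x) \<longlongrightarrow> A *v (LINT t:{0..}|lborel. x t)) at_top"
    by (intro bounded_linear.tendsto[OF matrix_vector_mul_bounded_linear] tendsto_integral_Icc_at_top int)
  moreover have "\<forall>\<^sub>F T in at_top. A *v integral {0..T} x = x T - x 0"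
    using eventually_ge_at_top[of 0]
  proof eventually_elim
    fix T :: real assume T: "0 \<le> T"
    have "x integrable_on {0..T}"
      by (intro integrable_continuous_interval continuous_on_subset[OF cont]) auto
    from integral_linear[OF this matrix_vector_mul_bounded_linear[of A]]
    show "A *v integral {0..T} x = x T - x 0"
      using x[OF T] by (simp add: comp_def)
  qed
  ultimately have "((\<lambda>T. x T - x 0) \<longlongrightarrow> A *v (LINT t:{0..}|lborel. x t)) at_top"
    by (rule Lim_transform_eventually)
  moreover have "((\<lambda>T. x T - x 0) \<longlongrightarrow> 0 - x 0) at_top"
    by (intro tendsto_intros lim)
  ultimately show "A *v (LINT t:{0..}|lborel. x t) = - x 0"
    using tendsto_unique[OF trivial_limit_at_top_linorder] by (metis diff_0)
qed

end

section \<open>Isotropic normal vectors\<close>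

text \<open>Brownian increments are specified by a joint density; here it is turned into laws,
  moments and independence of the coordinates. The measure of rectangles yields both the marginals
  and the product law.\<close>

locale isotropic_normal_vector = prob_space M for M :: "'a measure" +
  fixes w :: "'a \<Rightarrow> real ^ 'n" and s :: real
  assumes s_pos: "s > 0"
    and w_distributed:
      "distributed M lborel w (\<lambda>x. \<Prod>i\<in>UNIV. ennreal (normal_density 0 s (x $ i)))"
begin

abbreviation component_law :: "real measure" where
  "component_law \<equiv> density lborel (\<lambda>x. ennreal (normal_density 0 s x))"

lemma w_measurable [measurable]: "w \<in> borel_measurable M"
  using distributed_measurable[OF w_distributed] by simp

lemma component_measurable [measurable]: "(\<lambda>\<omega>. w \<omega> $ i) \<in> borel_measurable M"
  using borel_measurable_nth[of i] by (rule measurable_compose[OF w_measurable])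

lemma emeasure_rectangle:
  assumes B: "\<And>i. B i \<in> sets borel"
  shows "emeasure M {\<omega> \<in> space M. \<forall>i. w \<omega> $ i \<in> B i} = (\<Prod>i\<in>UNIV. emeasure component_law (B i))"
proof -
  let ?\<phi> = "\<lambda>x. ennreal (normal_density 0 s x)"
  \<comment> \<open>Fubini for \<open>lborel\<close> runs over basis vectors while \<open>B\<close>
    is indexed by coordinates. The choice operator recovers i from \<open>axis i 1\<close>, uniquely
    because \<open>axis\<close> is injective.\<close>
  define f where "f b y = ?\<phi> y * indicator (B (SOME i. axis i 1 = b)) y" for b :: "real ^ 'n" and y
  have f_axis: "f (axis i 1) = (\<lambda>y. ?\<phi> y * indicator (B i) y)" for i
    by (rule ext) (simp add: f_def axis_eq_axis)
  have Basis: "Basis = range (\<lambda>i::'n. axis i (1::real))" by (auto simp: Basis_vec_def)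
  have inj: "inj (\<lambda>i::'n. axis i (1::real))" by (auto simp: inj_def axis_eq_axis)
  have R: "{x. \<forall>i. x $ i \<in> B i} \<in> sets borel"
  proof -
    have "{x. \<forall>i. x $ i \<in> B i} = (\<Inter>i. (\<lambda>x. x $ i) -` B i \<inter> space borel)" by auto
    also have "\<dots> \<in> sets borel"
      by (intro sets.finite_INT measurable_sets[OF borel_measurable_nth B]) auto
    finally show ?thesis .
  qed
  have "{\<omega> \<in> space M. \<forall>i. w \<omega> $ i \<in> B i} = w -` {x. \<forall>i. x $ i \<in> B i} \<inter> space M" by auto
  also have "emeasure M \<dots> = (\<integral>\<^sup>+x. (\<Prod>i\<in>UNIV. ?\<phi> (x $ i)) * indicator {x. \<forall>i. x $ i \<in> B i} x \<partial>lborel)"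
    using R by (intro distributed_emeasure[OF w_distributed]) simp
  also have "\<dots> = (\<integral>\<^sup>+x. (\<Prod>b\<in>Basis. f b (x \<bullet> b)) \<partial>lborel)"
  proof (rule nn_integral_cong)
    fix x :: "real ^ 'n"
    have "(\<Prod>b\<in>Basis. f b (x \<bullet> b)) = (\<Prod>i\<in>UNIV. ?\<phi> (x $ i) * indicator (B i) (x $ i))"
      unfolding Basis prod.reindex[OF inj] by (simp add: f_axis inner_axis)
    also have "\<dots> = (\<Prod>i\<in>UNIV. ?\<phi> (x $ i)) * indicator {x. \<forall>i. x $ i \<in> B i} x"
      by (auto simp: indicator_def prod.distrib)
    finally show "(\<Prod>i\<in>UNIV. ?\<phi> (x $ i)) * indicator {x. \<forall>i. x $ i \<in> B i} x =
      (\<Prod>b\<in>Basis. f b (x \<bullet> b))" by simp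
  qed
  also have "\<dots> = (\<Prod>b\<in>Basis. \<integral>\<^sup>+y. f b y \<partial>lborel)"
    using B by (intro nn_integral_lborel_prod) (auto simp: f_def)
  also have "\<dots> = (\<Prod>i\<in>UNIV. emeasure component_law (B i))"
    unfolding Basis prod.reindex[OF inj] using B by (auto simp: f_axis emeasure_density intro!: prod.cong)
  finally show ?thesis .
qed

sublocale component: prob_space component_law
  using s_pos by (rule prob_space_normal_density)

lemma distr_component: "distr M borel (\<lambda>\<omega>. w \<omega> $ i) = component_law"
proof (rule measure_eqI)
  fix B assume "B \<in> sets (distr M borel (\<lambda>\<omega>. w \<omega> $ i))"
  then have B: "B \<in> sets borel" by simp
  let ?B = "\<lambda>j. if j = i then B else UNIV"
  have "emeasure (distr M borel (\<lambda>\<omega>. w \<omega> $ i)) B = emeasure M {\<omega> \<in> space M. \<forall>j. w \<omega> $ j \<in> ?B j}"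
    using B by (subst emeasure_distr) (auto intro!: arg_cong[where f="emeasure M"])
  also have "\<dots> = (\<Prod>j\<in>UNIV. emeasure component_law (?B j))"
    using B by (intro emeasure_rectangle) auto
  also have "\<dots> = (\<Prod>j\<in>UNIV. if j = i then emeasure component_law B else 1)"
    using component.emeasure_space_1 by (intro prod.cong) auto
  also have "\<dots> = emeasure component_law B" by simp
  finally show "emeasure (distr M borel (\<lambda>\<omega>. w \<omega> $ i)) B = emeasure component_law B" .
qed simp

lemma component_distributed:
  "distributed M lborel (\<lambda>\<omega>. w \<omega> $ i) (\<lambda>x. ennreal (normal_density 0 s x))"
  unfolding distributed_def using distr_component[of i]
  by (auto intro!: measurable_compose[OF _ measurable_ennreal] cong: distr_cong)

text \<open>The reindexing by \<open>h\<close> serves \<open>chi_squared\<close>, whose product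
  measure lives on {..<k}; for mixed moments \<open>h\<close> is the identity.\<close>

lemma indep_components:
  assumes h: "bij_betw h I UNIV" and "finite I"
  shows "indep_vars (\<lambda>_. borel) (\<lambda>i \<omega>. w \<omega> $ h i) I"
proof -
  have psf: "product_sigma_finite (\<lambda>_. component_law)" ..
  have ne: "I \<noteq> {}" using h by (auto simp: bij_betw_def)
  have "distr M (\<Pi>\<^sub>M i\<in>I. borel) (\<lambda>\<omega>. \<lambda>i\<in>I. w \<omega> $ h i) = (\<Pi>\<^sub>M i\<in>I. component_law)"
  proof (rule product_sigma_finite.PiM_eqI[OF psf])
    show "sets (distr M (\<Pi>\<^sub>M i\<in>I. borel) (\<lambda>\<omega>. \<lambda>i\<in>I. w \<omega> $ h i)) = sets (\<Pi>\<^sub>M i\<in>I. component_law)"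
      by (simp cong: sets_PiM_cong)
    fix B assume B: "\<And>i. i \<in> I \<Longrightarrow> B i \<in> sets component_law"
    let ?k = "the_inv_into I h"
    have k: "\<And>j. ?k j \<in> I" "\<And>j. h (?k j) = j" "\<And>i. i \<in> I \<Longrightarrow> ?k (h i) = i"
      using h by (auto simp: bij_betw_def the_inv_into_into f_the_inv_into_f the_inv_into_f_f)
    have "emeasure (distr M (\<Pi>\<^sub>M i\<in>I. borel) (\<lambda>\<omega>. \<lambda>i\<in>I. w \<omega> $ h i)) (Pi\<^sub>E I B) =
       emeasure M ((\<lambda>\<omega>. \<lambda>i\<in>I. w \<omega> $ h i) -` Pi\<^sub>E I B \<inter> space M)"
      using B \<open>finite I\<close> by (intro emeasure_distr) (auto intro!: sets_PiM_I_finite)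
    also have "(\<lambda>\<omega>. \<lambda>i\<in>I. w \<omega> $ h i) -` Pi\<^sub>E I B \<inter> space M = {\<omega> \<in> space M. \<forall>j. w \<omega> $ j \<in> B (?k j)}"
    proof -
      have "(\<forall>i\<in>I. w \<omega> $ h i \<in> B i) \<longleftrightarrow> (\<forall>j. w \<omega> $ j \<in> B (?k j))" for \<omega>
        using k by metis
      then show ?thesis by (auto simp: PiE_iff)
    qed
    also have "emeasure M \<dots> = (\<Prod>j\<in>UNIV. emeasure component_law (B (?k j)))"
      using B k by (intro emeasure_rectangle) auto
    also have "\<dots> = (\<Prod>i\<in>I. emeasure component_law (B i))"
      using k by (intro prod.reindex_bij_witness[where i=h and j="?k"]) auto
    finally show "emeasure (distr M (\<Pi>\<^sub>M i\<in>I. borel) (\<lambda>\<omega>. \<lambda>i\<in>I. w \<omega> $ h i)) (Pi\<^sub>E I B) =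
      (\<Prod>i\<in>I. emeasure component_law (B i))" .
  qed fact
  then show ?thesis
    by (subst indep_vars_iff_distr_eq_PiM[OF ne]) (simp_all add: distr_component)
qed

lemma component_mean: "expectation (\<lambda>\<omega>. w \<omega> $ i) = 0"
  using normal_distributed_expectation[OF s_pos component_distributed] .

lemma component_square_integrable: "integrable M (\<lambda>\<omega>. (w \<omega> $ i)\<^sup>2)"
  using distributed_integrable[OF component_distributed, of "\<lambda>x. x\<^sup>2" i]
    integrable_normal_moment[OF s_pos, of 0 2] by simp

lemma component_integrable: "integrable M (\<lambda>\<omega>. w \<omega> $ i)"
  by (rule square_integrable_imp_integrable) (auto intro: component_square_integrable)

lemma component_second_moment: "expectation (\<lambda>\<omega>. (w \<omega> $ i)\<^sup>2) = s\<^sup>2"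
  using normal_distributed_variance[OF s_pos component_distributed, of i] by (simp add: component_mean)

lemma component_product_moment:
  "expectation (\<lambda>\<omega>. w \<omega> $ i * w \<omega> $ j) = (if i = j then s\<^sup>2 else 0)"
proof (cases "i = j")
  case True
  then show ?thesis using component_second_moment[of i] by (simp add: power2_eq_square)
next
  case False
  have "indep_vars (\<lambda>_. borel) (\<lambda>i \<omega>. w \<omega> $ i) UNIV"
    using indep_components[of id UNIV] by simp
  then have "indep_vars (\<lambda>_. borel) (\<lambda>i \<omega>. w \<omega> $ i) {i, j}"
    by (rule indep_vars_subset) simp
  from indep_vars_lebesgue_integral[OF _ this] show ?thesis
    using False by (simp add: component_integrable component_mean)
qed

lemma distr_norm_square: "distr M borel (\<lambda>\<omega>. (norm (w \<omega>) / s)\<^sup>2) = chi_squared CARD('n)"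
proof -
  let ?I = "{..<CARD('n)}"
  obtain h :: "nat \<Rightarrow> 'n" where h: "bij_betw h ?I UNIV"
    using ex_bij_betw_nat_finite[of "UNIV :: 'n set"] by (auto simp: atLeast0LessThan)
  have ne: "?I \<noteq> {}" using h by (auto simp: bij_betw_def)
  have std: "distr M borel (\<lambda>\<omega>. w \<omega> $ i / s) = density lborel (\<lambda>x. ennreal (std_normal_density x))" for i
  proof -
    have "distributed M lborel (\<lambda>\<omega>. (w \<omega> $ i - 0) / s) std_normal_density"
      using component_distributed[of i] normal_standard_normal_convert[OF s_pos, of "\<lambda>\<omega>. w \<omega> $ i" 0]
      by blast
    then show ?thesis by (simp add: distributed_def cong: distr_cong)
  qed
  have "indep_vars (\<lambda>_. borel) (\<lambda>i \<omega>. w \<omega> $ h i / s) ?I"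
    using indep_vars_compose2[OF indep_components[OF h], of "\<lambda>_ x. x / s" "\<lambda>_. borel"] by simp
  then have PiM: "distr M (\<Pi>\<^sub>M i\<in>?I. borel) (\<lambda>\<omega>. \<lambda>i\<in>?I. w \<omega> $ h i / s) =
      (\<Pi>\<^sub>M i\<in>?I. density lborel (\<lambda>x. ennreal (std_normal_density x)))"
    by (subst (asm) indep_vars_iff_distr_eq_PiM[OF ne]) (simp_all add: std)
  have "(norm (w \<omega>) / s)\<^sup>2 = (\<Sum>i\<in>?I. ((\<lambda>i\<in>?I. w \<omega> $ h i / s) i)\<^sup>2)" for \<omega>
  proof -
    have "(norm (w \<omega>) / s)\<^sup>2 = (\<Sum>j\<in>UNIV. (w \<omega> $ j / s)\<^sup>2)"
      by (simp add: power_divide power2_norm_eq_inner inner_vec_def sum_divide_distrib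
        flip: power2_eq_square)
    also have "\<dots> = (\<Sum>i\<in>?I. (w \<omega> $ h i / s)\<^sup>2)"
      by (rule sum.reindex_bij_betw[OF h, symmetric])
    finally show ?thesis by simp
  qed
  then have "distr M borel (\<lambda>\<omega>. (norm (w \<omega>) / s)\<^sup>2) =
    distr (distr M (\<Pi>\<^sub>M i\<in>?I. borel) (\<lambda>\<omega>. \<lambda>i\<in>?I. w \<omega> $ h i / s)) borel (\<lambda>x. \<Sum>i\<in>?I. (x i)\<^sup>2)"
    by (subst distr_distr) (auto simp: comp_def)
  then show ?thesis unfolding PiM chi_squared_def .
qed

end

section \<open>The chi-squared law with two degrees of freedom\<close>

abbreviation std_normal :: "real measure" where
  "std_normal \<equiv> density lborel (\<lambda>x. ennreal (std_normal_density x))"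

text \<open>In the application \<open>k\<close> is 1 + s^2. The factor |x| makes - exp(- x^2 k / 2)
  / k an antiderivative on the positive half-line, and evenness doubles the result; \<open>a\<close>
  is the point where x^2 k reaches d.\<close>

lemma nn_integral_abs_exp_tail:
  fixes k d :: real
  assumes k: "k > 0" and d: "d \<ge> 0"
  shows "(\<integral>\<^sup>+x. ennreal (\<bar>x\<bar> * exp (- x\<^sup>2 * k / 2)) * indicator {x. d \<le> x\<^sup>2 * k} x \<partial>lborel)
    = ennreal (2 * exp (- d / 2) / k)"
proof -
  define a where "a = sqrt (d / k)"
  have a: "a \<ge> 0" "a\<^sup>2 * k = d" using k d by (auto simp: a_def)
  have "has_bochner_integral lborel (\<lambda>x. indicator {a..} x *\<^sub>R (x * exp (- x\<^sup>2 * k / 2)))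
      (exp (- d / 2) / k)"
  proof (rule has_bochner_integral_nn_integral)
    have "((\<lambda>x. - exp (- x\<^sup>2 * k / 2) / k) \<longlongrightarrow> 0) at_top"
      using k by real_asymp
    then have "(\<integral>\<^sup>+x. ennreal (x * exp (- x\<^sup>2 * k / 2)) * indicator {a..} x \<partial>lborel)
      = ennreal (0 - - exp (- a\<^sup>2 * k / 2) / k)"
      using k a by (intro nn_integral_FTC_atLeast) (auto intro!: derivative_eq_intros)
    moreover have "(\<integral>\<^sup>+x. ennreal (x * exp (- x\<^sup>2 * k / 2)) * indicator {a..} x \<partial>lborel) =
      (\<integral>\<^sup>+x. ennreal (indicator {a..} x *\<^sub>R (x * exp (- x\<^sup>2 * k / 2))) \<partial>lborel)"
      by (intro nn_integral_cong) (auto simp: indicator_def)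
    ultimately show "(\<integral>\<^sup>+x. ennreal (indicator {a..} x *\<^sub>R (x * exp (- x\<^sup>2 * k / 2))) \<partial>lborel) = ennreal (exp (- d / 2) / k)"
      using a by simp
  qed (use a k in \<open>auto simp: indicator_def\<close>)
  also have "(\<lambda>x. indicator {a..} x *\<^sub>R (x * exp (- x\<^sup>2 * k / 2)))
     = (\<lambda>x. indicator {0..} x *\<^sub>R (\<bar>x\<bar> * exp (- x\<^sup>2 * k / 2) * indicator {x. d \<le> x\<^sup>2 * k} x))"
  proof
    fix x :: real
    have "d \<le> x\<^sup>2 * k \<longleftrightarrow> a \<le> \<bar>x\<bar>"
      using k a by (metis abs_ge_zero abs_of_nonneg mult_le_cancel_right_pos power2_abs power2_le_imp_le power_mono)
    then show "indicator {a..} x *\<^sub>R (x * exp (- x\<^sup>2 * k / 2)) =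
        indicator {0..} x *\<^sub>R (\<bar>x\<bar> * exp (- x\<^sup>2 * k / 2) * indicator {x. d \<le> x\<^sup>2 * k} x)"
      using a by (auto simp: indicator_def)
  qed
  finally have "has_bochner_integral lborel
      (\<lambda>x. indicator {0..} x *\<^sub>R (\<bar>x\<bar> * exp (- x\<^sup>2 * k / 2) * indicator {x. d \<le> x\<^sup>2 * k} x))
      (exp (- d / 2) / k)" .
  from has_bochner_integral_even_function[OF this]
  have "has_bochner_integral lborel (\<lambda>x. \<bar>x\<bar> * exp (- x\<^sup>2 * k / 2) * indicator {x. d \<le> x\<^sup>2 * k} x)
      (2 * (exp (- d / 2) / k))"
    by (simp add: indicator_def)
  then have "(\<integral>\<^sup>+x. ennreal (\<bar>x\<bar> * exp (- x\<^sup>2 * k / 2) * indicator {x. d \<le> x\<^sup>2 * k} x) \<partial>lborel)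
    = ennreal (2 * (exp (- d / 2) / k))"
    by (subst nn_integral_eq_integral) (auto simp: has_bochner_integral_iff)
  then show ?thesis
    by (simp add: ennreal_mult'' ennreal_indicator)
qed

lemma nn_integral_inverse_1_plus_square:
  "(\<integral>\<^sup>+x. ennreal (1 / (1 + x\<^sup>2)) \<partial>lborel) = ennreal pi"
proof -
  have p: "1 + x\<^sup>2 > 0" for x :: real by (simp add: add_pos_nonneg)
  have "has_bochner_integral lborel (\<lambda>x. indicator {0..} x *\<^sub>R (1 / (1 + x\<^sup>2))) (pi / 2)"
  proof (rule has_bochner_integral_nn_integral)
    have "(\<integral>\<^sup>+x. ennreal (1 / (1 + x\<^sup>2)) * indicator {0..} x \<partial>lborel) = ennreal (pi / 2 - arctan 0)"
      using p by (intro nn_integral_FTC_atLeast)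
       (auto intro!: derivative_eq_intros tendsto_arctan_at_top simp: field_simps less_imp_le)
    moreover have "(\<integral>\<^sup>+x. ennreal (1 / (1 + x\<^sup>2)) * indicator {0..} x \<partial>lborel) =
      (\<integral>\<^sup>+x. ennreal (indicator {0..} x *\<^sub>R (1 / (1 + x\<^sup>2))) \<partial>lborel)"
      by (intro nn_integral_cong) (auto simp: indicator_def)
    ultimately show "(\<integral>\<^sup>+x. ennreal (indicator {0..} x *\<^sub>R (1 / (1 + x\<^sup>2))) \<partial>lborel) = ennreal (pi / 2)"
      by simp
  qed (auto simp: indicator_def)
  from has_bochner_integral_even_function[OF this]
  have "has_bochner_integral lborel (\<lambda>x::real. 1 / (1 + x\<^sup>2)) pi"
    by simp
  then show ?thesis
    by (subst nn_integral_eq_integral) (auto simp: has_bochner_integral_iff)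
qed

interpretation std_normal: prob_space std_normal
  by (rule prob_space_normal_density) simp

lemma chi_squared_tail_nn_integral:
  "emeasure (chi_squared 2) {d..} =
     (\<integral>\<^sup>+x. \<integral>\<^sup>+y. indicator {d..} (x\<^sup>2 + y\<^sup>2) \<partial>std_normal \<partial>std_normal)"
proof -
  interpret product_sigma_finite "\<lambda>_::nat. std_normal" ..
  have two: "{..<2::nat} = insert 1 {0}" by auto
  have "emeasure (chi_squared 2) {d..} =
    (\<integral>\<^sup>+x. indicator {d..} (\<Sum>i<2. (x i)\<^sup>2) \<partial>Pi\<^sub>M {..<2::nat} (\<lambda>_. std_normal))"
    unfolding chi_squared_def
    by (subst nn_integral_indicator[symmetric], simp, subst nn_integral_distr) auto
  also have "\<dots> = (\<integral>\<^sup>+x. indicator {d..} (x 0 ^ 2 + x 1 ^ 2)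
      \<partial>Pi\<^sub>M (insert 1 {0::nat}) (\<lambda>_. std_normal))"
    unfolding two by (simp add: add.commute)
  also have "\<dots> = (\<integral>\<^sup>+x. \<integral>\<^sup>+y. indicator {d..} (x 0 ^ 2 + y ^ 2) \<partial>std_normal
      \<partial>Pi\<^sub>M {0::nat} (\<lambda>_. std_normal))"
    by (subst product_nn_integral_insert) auto
  also have "\<dots> = (\<integral>\<^sup>+x. \<integral>\<^sup>+y. indicator {d..} (x ^ 2 + y ^ 2) \<partial>std_normal \<partial>std_normal)"
    by (rule product_nn_integral_singleton[where f="\<lambda>x. \<integral>\<^sup>+y. indicator {d..} (x ^ 2 + y ^ 2) \<partial>std_normal"])
       measurable
  finally show ?thesis .
qed

text \<open>The substitution \<open>y = x s\<close> replaces polar coordinates.\<close>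
lemma emeasure_chi_squared_2_tail:
  assumes d: "d \<ge> 0"
  shows "emeasure (chi_squared 2) {d..} = ennreal (exp (- d / 2))"
proof -
  let ?\<phi> = "\<lambda>x. ennreal (std_normal_density x)"
  have inner: "?\<phi> x * (\<integral>\<^sup>+y. ?\<phi> y * indicator {d..} (x\<^sup>2 + y\<^sup>2) \<partial>lborel) =
      (\<integral>\<^sup>+s. ennreal (1 / (2 * pi)) * (ennreal (\<bar>x\<bar> * exp (- x\<^sup>2 * (1 + s\<^sup>2) / 2)) *
          indicator {x. d \<le> x\<^sup>2 * (1 + s\<^sup>2)} x) \<partial>lborel)"
    if x: "x \<noteq> 0" for x
  proof -
    have affine: "(\<integral>\<^sup>+y. ?\<phi> y * indicator {d..} (x\<^sup>2 + y\<^sup>2) \<partial>lborel) =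
       ennreal \<bar>x\<bar> * (\<integral>\<^sup>+s. ?\<phi> (0 + x * s) * indicator {d..} (x\<^sup>2 + (0 + x * s)\<^sup>2) \<partial>lborel)"
      by (rule nn_integral_real_affine) (use x in auto)
    have "?\<phi> x * (\<integral>\<^sup>+y. ?\<phi> y * indicator {d..} (x\<^sup>2 + y\<^sup>2) \<partial>lborel) = (\<integral>\<^sup>+s. ?\<phi> x * (ennreal \<bar>x\<bar> *
        (?\<phi> (x * s) * indicator {d..} (x\<^sup>2 + (x * s)\<^sup>2))) \<partial>lborel)"
      unfolding affine by (simp add: nn_integral_cmult)
    also have "\<dots> = (\<integral>\<^sup>+s. ennreal (1 / (2 * pi)) * (ennreal (\<bar>x\<bar> * exp (- x\<^sup>2 * (1 + s\<^sup>2) / 2)) *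
          indicator {x. d \<le> x\<^sup>2 * (1 + s\<^sup>2)} x) \<partial>lborel)"
    proof (rule nn_integral_cong)
      fix s :: real
      have *: "std_normal_density x * (\<bar>x\<bar> * std_normal_density (x * s)) =
         1 / (2 * pi) * (\<bar>x\<bar> * exp (- x\<^sup>2 * (1 + s\<^sup>2) / 2))"
      proof -
        have e: "exp (- x\<^sup>2 / 2) * exp (- (x * s)\<^sup>2 / 2) = exp (- x\<^sup>2 * (1 + s\<^sup>2) / 2)"
        proof -
          have "- x\<^sup>2 / 2 + - (x * s)\<^sup>2 / 2 = - x\<^sup>2 * (1 + s\<^sup>2) / 2"
            by (simp add: power_mult_distrib distrib_left add_divide_distrib)
          then show ?thesis by (metis exp_add)
        qed
        have "std_normal_density x * (\<bar>x\<bar> * std_normal_density (x * s)) =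
            (1 / sqrt (2 * pi) * (1 / sqrt (2 * pi))) * (\<bar>x\<bar> * (exp (- x\<^sup>2 / 2) * exp (- (x * s)\<^sup>2 / 2)))"
          by (simp only: std_normal_density_def mult_ac)
        then show ?thesis unfolding e by simp
      qed
      have "?\<phi> x * (ennreal \<bar>x\<bar> * ?\<phi> (x * s)) =
          ennreal (1 / (2 * pi)) * ennreal (\<bar>x\<bar> * exp (- x\<^sup>2 * (1 + s\<^sup>2) / 2))"
        using * by (simp add: ennreal_mult'[symmetric])
      moreover have "x\<^sup>2 + (x * s)\<^sup>2 = x\<^sup>2 * (1 + s\<^sup>2)" by (simp add: algebra_simps)
      ultimately show "?\<phi> x * (ennreal \<bar>x\<bar> * (?\<phi> (x * s) * indicator {d..} (x\<^sup>2 + (x * s)\<^sup>2))) =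
        ennreal (1 / (2 * pi)) * (ennreal (\<bar>x\<bar> * exp (- x\<^sup>2 * (1 + s\<^sup>2) / 2)) *
          indicator {x. d \<le> x\<^sup>2 * (1 + s\<^sup>2)} x)"
        by (auto simp: indicator_def)
    qed
    finally show ?thesis .
  qed
  have "emeasure (chi_squared 2) {d..} =
     (\<integral>\<^sup>+x. ?\<phi> x * (\<integral>\<^sup>+y. ?\<phi> y * indicator {d..} (x\<^sup>2 + y\<^sup>2) \<partial>lborel) \<partial>lborel)"
    unfolding chi_squared_tail_nn_integral
    by (subst nn_integral_density, simp, measurable, subst nn_integral_density) auto
  also have "\<dots> = (\<integral>\<^sup>+x. \<integral>\<^sup>+s. ennreal (1 / (2 * pi)) *
      (ennreal (\<bar>x\<bar> * exp (- x\<^sup>2 * (1 + s\<^sup>2) / 2)) *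
          indicator {x. d \<le> x\<^sup>2 * (1 + s\<^sup>2)} x) \<partial>lborel \<partial>lborel)"
    by (intro nn_integral_cong_AE) (use AE_lborel_singleton[of "0::real"] in eventually_elim, rule inner)
  \<comment> \<open>After the swap the Jacobian |x| makes the inner Gaussian integral elementary: it
    contributes 2 exp(- d / 2) / (1 + s^2). What remains in s is the Cauchy density, whose total
    mass cancels the pi of the normalisation.\<close>
  also have "\<dots> = (\<integral>\<^sup>+s. \<integral>\<^sup>+x. ennreal (1 / (2 * pi)) *
      (ennreal (\<bar>x\<bar> * exp (- x\<^sup>2 * (1 + s\<^sup>2) / 2)) *
          indicator {x. d \<le> x\<^sup>2 * (1 + s\<^sup>2)} x) \<partial>lborel \<partial>lborel)"
    by (rule lborel_pair.Fubini'[symmetric]) measurable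
  also have "\<dots> = (\<integral>\<^sup>+s. ennreal (exp (- d / 2) / pi) * ennreal (1 / (1 + s\<^sup>2)) \<partial>lborel)"
  proof (intro nn_integral_cong)
    fix s :: real
    have k: "1 + s\<^sup>2 > 0" by (simp add: add_pos_nonneg)
    show "(\<integral>\<^sup>+x. ennreal (1 / (2 * pi)) * (ennreal (\<bar>x\<bar> * exp (- x\<^sup>2 * (1 + s\<^sup>2) / 2)) *
          indicator {x. d \<le> x\<^sup>2 * (1 + s\<^sup>2)} x) \<partial>lborel) =
        ennreal (exp (- d / 2) / pi) * ennreal (1 / (1 + s\<^sup>2))"
      using k by (subst nn_integral_cmult, measurable, subst nn_integral_abs_exp_tail[OF k d])
        (simp add: ennreal_mult'[symmetric])
  qed
  also have "\<dots> = ennreal (exp (- d / 2) / pi) * ennreal pi"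
    by (subst nn_integral_cmult) (auto simp: nn_integral_inverse_1_plus_square)
  also have "\<dots> = ennreal (exp (- d / 2))"
    by (simp add: ennreal_mult'[symmetric])
  finally show ?thesis .
qed

lemma prob_space_chi_squared: "prob_space (chi_squared k)"
  unfolding chi_squared_def
  by (intro prob_space.prob_space_distr prob_space_PiM std_normal.prob_space_axioms) measurable

lemma measure_chi_squared_2_tail: "d \<ge> 0 \<Longrightarrow> measure (chi_squared 2) {d..} = exp (- d / 2)"
  by (simp add: measure_def emeasure_chi_squared_2_tail)

text \<open>Uniqueness among all real d is what gives the \<open>THE\<close> in
  \<open>upper_critical_value\<close> its meaning. A negative d is excluded because the tail there
  already has mass 1, which exceeds \<alpha>.\<close>

lemma chi_squared_2_tail_eq_iff:
  assumes \<alpha>: "0 < \<alpha>" "\<alpha> < 1"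
  shows "measure (chi_squared 2) {d..} = \<alpha> \<longleftrightarrow> d = - 2 * ln \<alpha>"
proof (cases "d \<ge> 0")
  case True
  have "exp (- d / 2) = \<alpha> \<longleftrightarrow> - d / 2 = ln \<alpha>"
    using \<alpha> by (metis exp_ln ln_exp)
  then show ?thesis using True by (auto simp: measure_chi_squared_2_tail)
next
  case False
  interpret C: prob_space "chi_squared 2" by (rule prob_space_chi_squared)
  have "1 = measure (chi_squared 2) {0..}" by (simp add: measure_chi_squared_2_tail)
  also have "\<dots> \<le> measure (chi_squared 2) {d..}"
    using False by (intro C.finite_measure_mono) (auto simp: chi_squared_def)
  finally show ?thesis using \<alpha> False ln_less_zero[of \<alpha>] by auto
qed

lemma detection_threshold_eq:
  assumes "0 < \<alpha>" "\<alpha> < 1"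
  shows "detection_threshold \<alpha> = - 2 * ln \<alpha>"
  unfolding detection_threshold_def upper_critical_value_def
  by (simp add: chi_squared_2_tail_eq_iff[OF assms])

section \<open>Decimal values of the thresholds\<close>

lemma ln_2_bounds: "ln (2::real) \<in> {0.693147..0.693148}"
  using ln_approx_bounds[of 2 6] by (simp add: eval_nat_numeral)

lemma ln_5_4_bounds: "ln (5/4::real) \<in> {0.223143..0.223144}"
  using ln_approx_bounds[of "5/4" 3] by (simp add: eval_nat_numeral)

text \<open>The bounds rest on a series in (x - 1) / (x + 1). This ratio is 1/3 at 2 and 1/9 at 5/4
  but 9/11 at 10, so the detour through 10 = 8 * 5/4 saves many terms.\<close>

lemma ln_10_eq: "ln (10::real) = 3 * ln 2 + ln (5/4)"
proof -
  have "ln (10::real) = ln (2 ^ 3 * (5/4))" by simp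
  also have "\<dots> = 3 * ln 2 + ln (5/4)" by (subst ln_mult_pos) (simp_all only: ln_realpow, simp_all)
  finally show ?thesis .
qed

lemma detection_threshold_10: "\<bar>detection_threshold (10 / 100) - 4605 / 1000\<bar> < 5 / 10000"
proof -
  have "ln (10 / 100 :: real) = - ln 10" by (simp add: ln_div)
  then show ?thesis using ln_2_bounds ln_5_4_bounds
    by (subst detection_threshold_eq) (auto simp: ln_10_eq abs_less_iff)
qed

text \<open>The tightest of the three cases: the exact value 5.99146... leaves a margin below 4e-5
  to the rounding limit, which dictates the six digits in the bounds on the logarithms.\<close>

lemma detection_threshold_5: "\<bar>detection_threshold (5 / 100) - 5991 / 1000\<bar> < 5 / 10000"
proof -
  have "ln (5 / 100 :: real) = - ln (2 * 10)" by (simp add: ln_div)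
  also have "\<dots> = - (ln 2 + ln 10)" by (subst ln_mult) auto
  finally show ?thesis using ln_2_bounds ln_5_4_bounds
    by (subst detection_threshold_eq) (auto simp: ln_10_eq abs_less_iff)
qed

lemma detection_threshold_1: "\<bar>detection_threshold (1 / 100) - 9210 / 1000\<bar> < 5 / 10000"
proof -
  have "ln (1 / 100 :: real) = - ln (10 * 10)" by (simp add: ln_div)
  also have "\<dots> = - (ln 10 + ln 10)" by (subst ln_mult) auto
  finally show ?thesis using ln_2_bounds ln_5_4_bounds
    by (subst detection_threshold_eq) (auto simp: ln_10_eq abs_less_iff)
qed

section \<open>Second moments of the stationary process\<close>

text \<open>Stability enters through an arbitrary Lyapunov form, so moments and long-run covariance
  are treated in every dimension; dimension 2 returns with the chi-squared tail and the concrete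
  matrix.\<close>

locale stable_ou_process =
  stationary_ou_process M F W A \<sigma> \<xi> + lyapunov_form A P \<kappa> K c
  for M :: "'a measure" and F :: "real \<Rightarrow> 'a measure" and W :: "real \<Rightarrow> 'a \<Rightarrow> real ^ 'n"
    and A :: "real ^ 'n ^ 'n" and \<sigma> :: real and \<xi> :: "real \<Rightarrow> 'a \<Rightarrow> real ^ 'n"
    and P :: "real ^ 'n ^ 'n" and \<kappa> K c :: real +
  assumes \<sigma>_pos: "\<sigma> > 0"
begin

lemma \<xi>_measurable [measurable]: "\<xi> s \<in> borel_measurable M"
  by (rule measurable_from_subalg[OF subalgebra_F \<xi>_adapted])

lemma \<xi>_component_measurable [measurable]: "(\<lambda>\<omega>. \<xi> s \<omega> $ i) \<in> borel_measurable M"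
  using borel_measurable_nth[of i] by (rule measurable_compose[OF \<xi>_measurable])

declare W_measurable [measurable]

lemma increment_component_measurable [measurable]:
  "(\<lambda>\<omega>. (W u \<omega> - W s \<omega>) $ i) \<in> borel_measurable M"
proof -
  have "(\<lambda>\<omega>. W u \<omega> - W s \<omega>) \<in> borel_measurable M" by measurable
  then show ?thesis using borel_measurable_nth[of i] by (rule measurable_compose)
qed

lemma \<xi>_component_continuous: "\<omega> \<in> space M \<Longrightarrow> continuous_on UNIV (\<lambda>s. \<xi> s \<omega> $ i)"
  by (intro continuous_intros \<xi>_continuous)

lemma increment_normal:
  "s < u \<Longrightarrow> isotropic_normal_vector M (\<lambda>\<omega>. W u \<omega> - W s \<omega>) (sqrt (u - s))"
  by unfold_locales (simp_all add: W_increment_normal)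

lemma increment_moments:
  assumes "s \<le> u"
  shows increment_square_integrable: "integrable M (\<lambda>\<omega>. ((W u \<omega> - W s \<omega>) $ i)\<^sup>2)"
    and increment_product_moment: "expectation (\<lambda>\<omega>. (W u \<omega> - W s \<omega>) $ i * (W u \<omega> - W s \<omega>) $ j)
      = (if i = j then u - s else 0)"
proof -
  have *: "integrable M (\<lambda>\<omega>. ((W u \<omega> - W s \<omega>) $ i)\<^sup>2) \<and>
     expectation (\<lambda>\<omega>. (W u \<omega> - W s \<omega>) $ i * (W u \<omega> - W s \<omega>) $ j) = (if i = j then u - s else 0)"
  proof (cases "s = u")
    case False
    then interpret N: isotropic_normal_vector M "\<lambda>\<omega>. W u \<omega> - W s \<omega>" "sqrt (u - s)"
      using assms by (intro increment_normal) simp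
    show ?thesis
      using N.component_square_integrable[of i] N.component_product_moment[of i j] assms by simp
  qed simp
  then show "integrable M (\<lambda>\<omega>. ((W u \<omega> - W s \<omega>) $ i)\<^sup>2)"
    and "expectation (\<lambda>\<omega>. (W u \<omega> - W s \<omega>) $ i * (W u \<omega> - W s \<omega>) $ j) = (if i = j then u - s else 0)"
    by blast+
qed

lemma increment_norm_square:
  assumes "s \<le> u"
  shows "integrable M (\<lambda>\<omega>. (norm (W u \<omega> - W s \<omega>))\<^sup>2)"
    and "expectation (\<lambda>\<omega>. (norm (W u \<omega> - W s \<omega>))\<^sup>2) = real CARD('n) * (u - s)"
proof -
  have eq: "(norm (W u \<omega> - W s \<omega>))\<^sup>2 = (\<Sum>i\<in>UNIV. ((W u \<omega> - W s \<omega>) $ i)\<^sup>2)" for \<omega>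
    unfolding power2_norm_eq_inner inner_vec_def by (simp add: power2_eq_square)
  have "expectation (\<lambda>\<omega>. ((W u \<omega> - W s \<omega>) $ i)\<^sup>2) = u - s" for i
    using increment_product_moment[OF assms, of i i] by (simp add: power2_eq_square)
  then show "integrable M (\<lambda>\<omega>. (norm (W u \<omega> - W s \<omega>))\<^sup>2)"
    and "expectation (\<lambda>\<omega>. (norm (W u \<omega> - W s \<omega>))\<^sup>2) = real CARD('n) * (u - s)"
    unfolding eq using increment_square_integrable[OF assms]
    by (simp_all del: vector_minus_component)
qed

text \<open>Independence is assumed between sigma-algebras. Passing to those generated by
  \<open>Z\<close> and by one coordinate of the increment makes the expectation factor, and the
  increment has mean zero.\<close>

lemma increment_independent_expectation:
  assumes "s \<le> u" and Z: "Z \<in> borel_measurable (F s)" and Z_int: "integrable M Z"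
  shows "expectation (\<lambda>\<omega>. Z \<omega> * (W u \<omega> - W s \<omega>) $ i) = 0"
proof (cases "s = u")
  case False
  then have su: "s < u" using assms by simp
  interpret N: isotropic_normal_vector M "\<lambda>\<omega>. W u \<omega> - W s \<omega>" "sqrt (u - s)"
    by (rule increment_normal[OF su])
  let ?w = "\<lambda>\<omega>. (W u \<omega> - W s \<omega>) $ i"
  let ?V = "vimage_algebra (space M) (\<lambda>\<omega>. W u \<omega> - W s \<omega>) borel"
  have space_F: "space (F s) = space M" by (rule space_F)
  have "indep_set (sigma_sets (space M) {Z -` B \<inter> space M |B. B \<in> sets borel})
     (sigma_sets (space M) {?w -` B \<inter> space M |B. B \<in> sets borel})"
  proof (rule indep_setI)
    have sub1: "sigma_sets (space M) {Z -` B \<inter> space M |B. B \<in> sets borel} \<subseteq> sets (F s)"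
      unfolding space_F[symmetric] by (rule sets.sigma_sets_subset) (use Z in \<open>auto intro: measurable_sets\<close>)
    have w_V: "?w \<in> borel_measurable ?V"
      by (rule measurable_compose[OF measurable_vimage_algebra1 borel_measurable_nth[of i]]) simp
    have sub2: "sigma_sets (space M) {?w -` B \<inter> space M |B. B \<in> sets borel} \<subseteq> sets ?V"
      using sets.sigma_sets_subset[of "{?w -` B \<inter> space M |B. B \<in> sets borel}" ?V] measurable_sets[OF w_V]
      by auto
    note ind = W_increment_indep[OF su]
    have V_M: "sets ?V \<subseteq> events" and F_M: "sets (F s) \<subseteq> events"
      using ind by (auto simp: indep_set_def indep_sets_def split: bool.splits)
    show "sigma_sets (space M) {Z -` B \<inter> space M |B. B \<in> sets borel} \<subseteq> events"
      using sub1 F_M by blast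
    show "sigma_sets (space M) {?w -` B \<inter> space M |B. B \<in> sets borel} \<subseteq> events"
      using sub2 V_M by blast
    fix a b assume "a \<in> sigma_sets (space M) {Z -` B \<inter> space M |B. B \<in> sets borel}"
      "b \<in> sigma_sets (space M) {?w -` B \<inter> space M |B. B \<in> sets borel}"
    with sub1 sub2 show "prob (a \<inter> b) = prob a * prob b"
      using indep_setD[OF ind] by blast
  qed
  then have "indep_var borel Z borel ?w"
    unfolding indep_var_eq
    using measurable_from_subalg[OF subalgebra_F Z] increment_component_measurable by blast
  from indep_var_lebesgue_integral[OF this Z_int N.component_integrable] show ?thesis
    by (simp only: N.component_mean mult_zero_right)
qed simp

text \<open>Strict stationarity speaks of the law on path space; evaluation at two times is a
  measurable projection of it.\<close>

lemma stationary_pair: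
  "distr M (borel \<Otimes>\<^sub>M borel) (\<lambda>\<omega>. (\<xi> (s + h) \<omega>, \<xi> (u + h) \<omega>)) =
   distr M (borel \<Otimes>\<^sub>M borel) (\<lambda>\<omega>. (\<xi> s \<omega>, \<xi> u \<omega>))"
proof -
  let ?N = "\<Pi>\<^sub>M s\<in>UNIV. borel :: (real ^ 'n) measure"
  have m: "(\<lambda>\<omega> s. \<xi> (s + h) \<omega>) \<in> measurable M ?N" for h
    by (rule measurable_PiM_single') (auto simp: space_PiM)
  have p: "(\<lambda>x. (x s, x u)) \<in> measurable ?N (borel \<Otimes>\<^sub>M borel)"
    by measurable
  have "distr M ?N (\<lambda>\<omega> s. \<xi> (s + h) \<omega>) = distr M ?N (\<lambda>\<omega> s. \<xi> (s + 0) \<omega>)"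
    using \<xi>_stationary by (simp add: strictly_stationary_def)
  then have "distr (distr M ?N (\<lambda>\<omega> s. \<xi> (s + h) \<omega>)) (borel \<Otimes>\<^sub>M borel) (\<lambda>x. (x s, x u)) =
     distr (distr M ?N (\<lambda>\<omega> s. \<xi> (s + 0) \<omega>)) (borel \<Otimes>\<^sub>M borel) (\<lambda>x. (x s, x u))"
    by (rule arg_cong)
  then show ?thesis
    unfolding distr_distr[OF p m] by (simp add: comp_def)
qed

lemma stationary_expectation:
  fixes f :: "(real ^ 'n) \<times> (real ^ 'n) \<Rightarrow> real"
  assumes f: "f \<in> borel_measurable (borel \<Otimes>\<^sub>M borel)"
  shows "expectation (\<lambda>\<omega>. f (\<xi> (s + h) \<omega>, \<xi> (u + h) \<omega>)) = expectation (\<lambda>\<omega>. f (\<xi> s \<omega>, \<xi> u \<omega>))"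
    and "integrable M (\<lambda>\<omega>. f (\<xi> (s + h) \<omega>, \<xi> (u + h) \<omega>)) \<longleftrightarrow> integrable M (\<lambda>\<omega>. f (\<xi> s \<omega>, \<xi> u \<omega>))"
proof -
  have m: "(\<lambda>\<omega>. (\<xi> s \<omega>, \<xi> u \<omega>)) \<in> measurable M (borel \<Otimes>\<^sub>M borel)" for s u by measurable
  show "expectation (\<lambda>\<omega>. f (\<xi> (s + h) \<omega>, \<xi> (u + h) \<omega>)) = expectation (\<lambda>\<omega>. f (\<xi> s \<omega>, \<xi> u \<omega>))"
    unfolding integral_distr[OF m f, symmetric] by (simp only: stationary_pair)
  show "integrable M (\<lambda>\<omega>. f (\<xi> (s + h) \<omega>, \<xi> (u + h) \<omega>)) \<longleftrightarrow> integrable M (\<lambda>\<omega>. f (\<xi> s \<omega>, \<xi> u \<omega>))"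
    unfolding integrable_distr_eq[OF m f, symmetric] by (simp only: stationary_pair)
qed

lemma stationary_expectation_single:
  fixes f :: "real ^ 'n \<Rightarrow> real"
  assumes f [measurable]: "f \<in> borel_measurable borel"
  shows "expectation (\<lambda>\<omega>. f (\<xi> s \<omega>)) = expectation (\<lambda>\<omega>. f (\<xi> 0 \<omega>))"
    and "integrable M (\<lambda>\<omega>. f (\<xi> s \<omega>)) \<longleftrightarrow> integrable M (\<lambda>\<omega>. f (\<xi> 0 \<omega>))"
  using stationary_expectation[of "\<lambda>p. f (fst p)" 0 s 0] by simp_all

text \<open>\<open>L\<close> and \<open>B\<close> are uniform in \<open>s\<close>, which permits
  iteration, while \<open>H\<close> varies with \<open>s\<close> and only its expectation is
  bounded. The inequality is between random variables because the norms are not yet known to have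
  finite second moments.\<close>

lemma one_step_contraction:
  "\<exists>L B. L > 0 \<and> (\<forall>s. \<exists>H. integrable M H \<and> expectation H \<le> B \<and>
     (\<forall>\<omega>. H \<omega> \<ge> 0) \<and>
     (AE \<omega> in M. (norm (\<xi> (s + L) \<omega>))\<^sup>2 \<le> (norm (\<xi> s \<omega>))\<^sup>2 / 2 + H \<omega>))"
proof -
  obtain L where L: "L > 0" and L_half: "2 * exp (- c * L) * K / \<kappa> \<le> 1 / 2"
  proof -
    \<comment> \<open>The leading 2 comes from (a + b)^2 <= 2 a^2 + 2 b^2, which splits off the
      noise at the end of the step.\<close>
    have "((\<lambda>L. 2 * exp (- c * L) * K / \<kappa>) \<longlongrightarrow> 0) at_top"
      using c_pos \<kappa>_pos by real_asymp
    then have "\<forall>\<^sub>F L in at_top. 2 * exp (- c * L) * K / \<kappa> < 1 / 2"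
      by (rule order_tendstoD) simp
    with eventually_gt_at_top[of 0] have "\<forall>\<^sub>F L in at_top. L > 0 \<and> 2 * exp (- c * L) * K / \<kappa> \<le> 1 / 2"
      by eventually_elim simp
    then show thesis using that eventually_happens'[OF trivial_limit_at_top_linorder] by blast
  qed
  define a where "a = \<bar>\<sigma>\<bar> * onorm ((*v) A)"
  have a: "norm (\<sigma> *\<^sub>R (A *v x)) \<le> a * norm x" for x
    using onorm[OF matrix_vector_mul_bounded_linear, of A x]
    by (simp add: a_def mult_left_mono mult.assoc)
  define H where "H s \<omega> = 2 * K / (c * \<kappa>) * a\<^sup>2 * integral {s..s + L} (\<lambda>r. (norm (W r \<omega> - W s \<omega>))\<^sup>2)
    + 2 * \<sigma>\<^sup>2 * (norm (W (s + L) \<omega> - W s \<omega>))\<^sup>2" for s \<omega>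
  define B where "B = 2 * K / (c * \<kappa>) * a\<^sup>2 * (L * (real CARD('n) * L)) + 2 * \<sigma>\<^sup>2 * (real CARD('n) * L)"
  have cont_norm: "continuous_on UNIV (\<lambda>r. (norm (W r \<omega> - W s \<omega>))\<^sup>2)" if "\<omega> \<in> space M" for s \<omega>
    by (intro continuous_intros W_continuous that)
  have X_int: "integrable M (\<lambda>\<omega>. (norm (W r \<omega> - W s \<omega>))\<^sup>2)" if "r \<in> {s..s + L}" for r s
    using that by (intro increment_norm_square) auto
  have X_bound: "expectation (\<lambda>\<omega>. \<bar>(norm (W r \<omega> - W s \<omega>))\<^sup>2\<bar>) \<le> real CARD('n) * L"
    if "r \<in> {s..s + L}" for r s
    using that increment_norm_square(2)[of s r] by (simp add: mult_left_mono)
  have X_meas: "(\<lambda>\<omega>. (norm (W r \<omega> - W s \<omega>))\<^sup>2) \<in> borel_measurable M" for r s by measurable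
  note path = integrable_path_integral[OF X_meas cont_norm X_int X_bound]
    integrable_on_expectation[OF X_meas cont_norm X_int X_bound]
    expectation_path_integral(3)[OF X_meas cont_norm X_int X_bound]
  have path_le: "expectation (\<lambda>\<omega>. integral {s..s + L} (\<lambda>r. (norm (W r \<omega> - W s \<omega>))\<^sup>2)) \<le>
      L * (real CARD('n) * L)" for s
  proof -
    have "integral {s..s + L} (\<lambda>r. expectation (\<lambda>\<omega>. (norm (W r \<omega> - W s \<omega>))\<^sup>2)) \<le>
       integral {s..s + L} (\<lambda>r. real CARD('n) * L)"
      using X_bound by (intro integral_le path(2)) auto
    also have "\<dots> = L * (real CARD('n) * L)" using L by simp
    finally show ?thesis by (simp only: path(3))
  qed
  have H_int: "integrable M (H s)" for s
    unfolding H_def using path(1) increment_norm_square(1)[of s "s + L"] L by auto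
  have H_exp: "expectation (H s) \<le> B" for s
  proof -
    have "expectation (H s) = 2 * K / (c * \<kappa>) * a\<^sup>2 *
        expectation (\<lambda>\<omega>. integral {s..s + L} (\<lambda>r. (norm (W r \<omega> - W s \<omega>))\<^sup>2)) +
        2 * \<sigma>\<^sup>2 * expectation (\<lambda>\<omega>. (norm (W (s + L) \<omega> - W s \<omega>))\<^sup>2)"
      unfolding H_def using path(1) increment_norm_square(1)[of s "s + L"] L by simp
    also have "expectation (\<lambda>\<omega>. (norm (W (s + L) \<omega> - W s \<omega>))\<^sup>2) = real CARD('n) * L"
      using increment_norm_square(2)[of s "s + L"] L by simp
    finally show ?thesis
      unfolding B_def using path_le[of s] c_pos \<kappa>_pos K_nonneg by (simp add: mult_left_mono divide_right_mono)
  qed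
  have H_nonneg: "H s \<omega> \<ge> 0" for s \<omega>
  proof -
    \<comment> \<open>Outside \<open>space M\<close> the path need not be integrable; the integral
      is then 0 by convention, so \<open>H\<close> is nonnegative everywhere and not just almost
      surely.\<close>
    have "integral {s..s + L} (\<lambda>r. (norm (W r \<omega> - W s \<omega>))\<^sup>2) \<ge> 0"
      by (cases "(\<lambda>r. (norm (W r \<omega> - W s \<omega>))\<^sup>2) integrable_on {s..s + L}")
         (auto simp: integral_nonneg not_integrable_integral)
    then show ?thesis
      unfolding H_def using c_pos \<kappa>_pos K_nonneg
      by (intro add_nonneg_nonneg mult_nonneg_nonneg divide_nonneg_nonneg) auto
  qed
  have step: "AE \<omega> in M. (norm (\<xi> (s + L) \<omega>))\<^sup>2 \<le> (norm (\<xi> s \<omega>))\<^sup>2 / 2 + H s \<omega>" for s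
    using \<xi>_sde AE_space
  proof eventually_elim
    fix \<omega> assume sde: "\<forall>s u. s \<le> u \<longrightarrow> \<xi> u \<omega> - \<xi> s \<omega> =
        integral {s..u} (\<lambda>r. A *v \<xi> r \<omega>) + \<sigma> *\<^sub>R (W u \<omega> - W s \<omega>)" and \<omega>: "\<omega> \<in> space M"
    let ?w = "\<lambda>r. W r \<omega> - W s \<omega>"
    \<comment> \<open>Removing the noise since time \<open>s\<close> leaves a differentiable path
      with y' = A y + g. The rough path W survives only as the continuous forcing \<open>g\<close>,
      which \<open>forced_decay\<close> can handle.\<close>
    define y where "y r = \<xi> r \<omega> - \<sigma> *\<^sub>R ?w r" for r
    define g where "g r = \<sigma> *\<^sub>R (A *v ?w r)" for r
    have w_cont: "continuous_on S ?w" for S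
      by (intro continuous_intros continuous_on_subset[OF W_continuous[OF \<omega>]]) auto
    have g_cont: "continuous_on S g" for S
      unfolding g_def
      by (intro continuous_intros bounded_linear.continuous_on[OF matrix_vector_mul_bounded_linear] w_cont)
    have A\<xi>_cont: "continuous_on S (\<lambda>r. A *v \<xi> r \<omega>)" for S
      by (intro bounded_linear.continuous_on[OF matrix_vector_mul_bounded_linear]
          continuous_on_subset[OF \<xi>_continuous[OF \<omega>]]) auto
    have y_eq: "y r = \<xi> s \<omega> + integral {s..r} (\<lambda>r. A *v \<xi> r \<omega>)" if "s \<le> r" for r
      using sde[rule_format, OF that] by (simp add: y_def algebra_simps)
    have "\<kappa> * (norm (y (s + L)))\<^sup>2 \<le>
      exp (- c * (s + L - s)) * K * (norm (y s))\<^sup>2 + K / c * integral {s..s + L} (\<lambda>r. (norm (g r))\<^sup>2)"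
    proof (rule forced_decay)
      fix t assume t: "t \<in> {s..s + L}"
      have "((\<lambda>r. \<xi> s \<omega> + integral {s..r} (\<lambda>r. A *v \<xi> r \<omega>)) has_vector_derivative A *v \<xi> t \<omega>)
          (at t within {s..s + L})"
        using integral_has_vector_derivative[OF A\<xi>_cont t] by (auto intro!: derivative_eq_intros)
      then have "(y has_vector_derivative A *v \<xi> t \<omega>) (at t within {s..s + L})"
        by (rule has_vector_derivative_transform[rotated 2]) (use t in simp, rule y_eq, simp)
      also have "A *v \<xi> t \<omega> = A *v y t + g t"
        by (simp add: y_def g_def matrix_vector_mult_diff_distrib matrix_vector_mult_scaleR)
      finally show "(y has_vector_derivative A *v y t + g t) (at t within {s..s + L})" .
    qed (use L g_cont in auto)
    also have "y s = \<xi> s \<omega>" by (simp add: y_def)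
    also have "integral {s..s + L} (\<lambda>r. (norm (g r))\<^sup>2) \<le> integral {s..s + L} (\<lambda>r. a\<^sup>2 * (norm (?w r))\<^sup>2)"
    proof (rule integral_le)
      show "(norm (g r))\<^sup>2 \<le> a\<^sup>2 * (norm (?w r))\<^sup>2" for r
        using power_mono[OF a[of "?w r"], of 2] by (simp add: g_def power_mult_distrib)
    qed (intro integrable_continuous_interval continuous_intros g_cont w_cont)+
    also have "\<dots> = a\<^sup>2 * integral {s..s + L} (\<lambda>r. (norm (?w r))\<^sup>2)" by simp
    finally have "\<kappa> * (norm (y (s + L)))\<^sup>2 \<le> exp (- c * L) * K * (norm (\<xi> s \<omega>))\<^sup>2 +
        K / c * (a\<^sup>2 * integral {s..s + L} (\<lambda>r. (norm (?w r))\<^sup>2))"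
      using K_nonneg c_pos by (simp add: mult_left_mono divide_right_mono)
    then have "2 / \<kappa> * (\<kappa> * (norm (y (s + L)))\<^sup>2) \<le> 2 / \<kappa> * (exp (- c * L) * K * (norm (\<xi> s \<omega>))\<^sup>2 +
        K / c * (a\<^sup>2 * integral {s..s + L} (\<lambda>r. (norm (?w r))\<^sup>2)))"
      using \<kappa>_pos by (intro mult_left_mono) auto
    then have "2 * (norm (y (s + L)))\<^sup>2 \<le> (2 * exp (- c * L) * K / \<kappa>) * (norm (\<xi> s \<omega>))\<^sup>2 +
        2 * K / (c * \<kappa>) * a\<^sup>2 * integral {s..s + L} (\<lambda>r. (norm (?w r))\<^sup>2)"
      using \<kappa>_pos by (simp add: field_simps)
    also have "(2 * exp (- c * L) * K / \<kappa>) * (norm (\<xi> s \<omega>))\<^sup>2 \<le> 1 / 2 * (norm (\<xi> s \<omega>))\<^sup>2"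
      by (intro mult_right_mono L_half) simp
    finally have y_le: "2 * (norm (y (s + L)))\<^sup>2 \<le> (norm (\<xi> s \<omega>))\<^sup>2 / 2 +
        2 * K / (c * \<kappa>) * a\<^sup>2 * integral {s..s + L} (\<lambda>r. (norm (?w r))\<^sup>2)" by simp
    have "norm (\<xi> (s + L) \<omega>) \<le> norm (y (s + L)) + norm (\<sigma> *\<^sub>R ?w (s + L))"
      using norm_triangle_ineq[of "y (s + L)" "\<sigma> *\<^sub>R ?w (s + L)"] by (simp add: y_def)
    then have "(norm (\<xi> (s + L) \<omega>))\<^sup>2 \<le> (norm (y (s + L)) + norm (\<sigma> *\<^sub>R ?w (s + L)))\<^sup>2"
      by (intro power_mono) auto
    also have "\<dots> \<le> 2 * (norm (y (s + L)))\<^sup>2 + 2 * (norm (\<sigma> *\<^sub>R ?w (s + L)))\<^sup>2"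
      using sum_squares_bound[of "norm (y (s + L))" "norm (\<sigma> *\<^sub>R ?w (s + L))"]
      by (simp add: power2_sum)
    also have "(norm (\<sigma> *\<^sub>R ?w (s + L)))\<^sup>2 = \<sigma>\<^sup>2 * (norm (?w (s + L)))\<^sup>2"
      by (simp add: power_mult_distrib)
    finally show "(norm (\<xi> (s + L) \<omega>))\<^sup>2 \<le> (norm (\<xi> s \<omega>))\<^sup>2 / 2 + H s \<omega>"
      using y_le unfolding H_def by linarith
  qed
  show ?thesis
    using L H_int H_exp H_nonneg step by blast
qed

end

context stable_ou_process
begin

text \<open>The error does not accumulate: 2 B is the fixed point of b -> b / 2 + B. Having all n at
  once makes it possible to send the weight of the initial value to 0 with the error bound
  kept.\<close>

lemma multi_step_contraction:
  "\<exists>L B. \<forall>n s. \<exists>H. integrable M H \<and> expectation H \<le> B \<and> (\<forall>\<omega>. H \<omega> \<ge> 0) \<and>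
     (AE \<omega> in M. (norm (\<xi> (s + real n * L) \<omega>))\<^sup>2 \<le> (norm (\<xi> s \<omega>))\<^sup>2 / 2 ^ n + H \<omega>)"
proof -
  obtain L B where step: "\<And>s. \<exists>H. integrable M H \<and> expectation H \<le> B \<and> (\<forall>\<omega>. H \<omega> \<ge> 0) \<and>
     (AE \<omega> in M. (norm (\<xi> (s + L) \<omega>))\<^sup>2 \<le> (norm (\<xi> s \<omega>))\<^sup>2 / 2 + H \<omega>)"
    by (rule exE[OF one_step_contraction]) blast
  have "B \<ge> 0"
  proof -
    obtain H where "integrable M H" "expectation H \<le> B" "\<forall>\<omega>. H \<omega> \<ge> 0"
      using step by blast
    then show ?thesis by (meson Bochner_Integration.integral_nonneg order_trans)
  qed
  have "\<exists>H. integrable M H \<and> expectation H \<le> 2 * B \<and> (\<forall>\<omega>. H \<omega> \<ge> 0) \<and>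
     (AE \<omega> in M. (norm (\<xi> (s + real n * L) \<omega>))\<^sup>2 \<le> (norm (\<xi> s \<omega>))\<^sup>2 / 2 ^ n + H \<omega>)" for n s
  proof (induction n)
    case 0
    show ?case using \<open>B \<ge> 0\<close> by (intro exI[of _ "\<lambda>_. 0"]) simp
  next
    case (Suc n)
    then obtain H where H: "integrable M H" "expectation H \<le> 2 * B" "\<forall>\<omega>. H \<omega> \<ge> 0"
      "AE \<omega> in M. (norm (\<xi> (s + real n * L) \<omega>))\<^sup>2 \<le> (norm (\<xi> s \<omega>))\<^sup>2 / 2 ^ n + H \<omega>" by blast
    obtain H' where H': "integrable M H'" "expectation H' \<le> B" "\<forall>\<omega>. H' \<omega> \<ge> 0"
      "AE \<omega> in M. (norm (\<xi> (s + real n * L + L) \<omega>))\<^sup>2 \<le> (norm (\<xi> (s + real n * L) \<omega>))\<^sup>2 / 2 + H' \<omega>"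
      using step by blast
    have eq: "s + real n * L + L = s + real (Suc n) * L" by (simp add: algebra_simps)
    have "AE \<omega> in M. (norm (\<xi> (s + real (Suc n) * L) \<omega>))\<^sup>2 \<le>
        (norm (\<xi> s \<omega>))\<^sup>2 / 2 ^ Suc n + (H \<omega> / 2 + H' \<omega>)"
      using H(4) H'(4)
    proof eventually_elim
      case (elim \<omega>)
      have chain: "b \<le> q + (h / 2 + h')" if "q = p / 2" "a \<le> p + h" "b \<le> a / 2 + h'" for a b h h' p q :: real
        using that by linarith
      show ?case by (rule chain[OF _ elim[unfolded eq]]) simp
    qed
    moreover have "expectation (\<lambda>\<omega>. H \<omega> / 2 + H' \<omega>) \<le> 2 * B"
      using H H' by simp
    moreover have "integrable M (\<lambda>\<omega>. H \<omega> / 2 + H' \<omega>)" using H(1) H'(1) by simp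
    moreover have "\<forall>\<omega>. H \<omega> / 2 + H' \<omega> \<ge> 0" using H(3) H'(3) by simp
    ultimately show ?case by blast
  qed
  then show ?thesis by blast
qed

text \<open>A stationary process contracting up to an integrable error is square integrable: truncation
  makes the expectations finite before stationarity is used to compare both ends.\<close>
lemma \<xi>_norm_square_integrable_0: "integrable M (\<lambda>\<omega>. (norm (\<xi> 0 \<omega>))\<^sup>2)"
proof -
  let ?V = "\<lambda>s \<omega>. (norm (\<xi> s \<omega>))\<^sup>2"
  obtain L B where steps: "\<And>n s. \<exists>H. integrable M H \<and> expectation H \<le> B \<and> (\<forall>\<omega>. H \<omega> \<ge> 0) \<and>
     (AE \<omega> in M. ?V (s + real n * L) \<omega> \<le> ?V s \<omega> / 2 ^ n + H \<omega>)"
    by (rule exE[OF multi_step_contraction]) blast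
  have trunc_int: "integrable M (\<lambda>\<omega>. min (?V s \<omega> / 2 ^ n) (real N))" for s n N
    by (rule integrable_const_bound[where B = "real N"]) (auto intro!: AE_I2)
  have trunc_step: "expectation (\<lambda>\<omega>. min (?V 0 \<omega>) (real N)) \<le>
      expectation (\<lambda>\<omega>. min (?V 0 \<omega> / 2 ^ n) (real N)) + B" for n N
  proof -
    \<comment> \<open>The n steps start in the past so that they end at time 0; stationarity then
      replaces the starting value by the one at 0.\<close>
    define s where "s = - real n * L"
    obtain H where H: "integrable M H" "expectation H \<le> B" "\<forall>\<omega>. H \<omega> \<ge> 0"
      "AE \<omega> in M. ?V (s + real n * L) \<omega> \<le> ?V s \<omega> / 2 ^ n + H \<omega>" using steps by blast
    have "expectation (\<lambda>\<omega>. min (?V 0 \<omega>) (real N)) \<le> expectation (\<lambda>\<omega>. min (?V s \<omega> / 2 ^ n) (real N) + H \<omega>)"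
    proof (rule integral_mono_AE)
      show "integrable M (\<lambda>\<omega>. min (?V 0 \<omega>) (real N))" using trunc_int[of 0 0 N] by simp
      show "integrable M (\<lambda>\<omega>. min (?V s \<omega> / 2 ^ n) (real N) + H \<omega>)" using trunc_int H(1) by simp
      show "AE \<omega> in M. min (?V 0 \<omega>) (real N) \<le> min (?V s \<omega> / 2 ^ n) (real N) + H \<omega>"
        using H(4)
      proof eventually_elim
        case (elim \<omega>)
        then show ?case using H(3)[rule_format, of \<omega>] by (simp add: s_def min_def)
      qed
    qed
    also have "\<dots> = expectation (\<lambda>\<omega>. min (?V s \<omega> / 2 ^ n) (real N)) + expectation H"
      using trunc_int H(1) by simp
    also have "expectation (\<lambda>\<omega>. min (?V s \<omega> / 2 ^ n) (real N)) = expectation (\<lambda>\<omega>. min (?V 0 \<omega> / 2 ^ n) (real N))"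
      by (rule stationary_expectation_single(1)) measurable
    finally show ?thesis using H(2) by linarith
  qed
  \<comment> \<open>For fixed N the constant N dominates, even though the second moment is not known
    to be finite; n -> infinity removes the initial value and leaves a bound free of N. Monotone
    convergence in N follows.\<close>
  have trunc_bound: "expectation (\<lambda>\<omega>. min (?V 0 \<omega>) (real N)) \<le> B" for N
  proof -
    have "(\<lambda>n. expectation (\<lambda>\<omega>. min (?V 0 \<omega> / 2 ^ n) (real N))) \<longlonglongrightarrow> expectation (\<lambda>_. 0)"
    proof (rule integral_dominated_convergence[where w = "\<lambda>_. real N"])
      show "AE \<omega> in M. (\<lambda>n. min (?V 0 \<omega> / 2 ^ n) (real N)) \<longlonglongrightarrow> 0"
      proof (rule AE_I2)
        fix \<omega>
        have "(\<lambda>n. ?V 0 \<omega> / 2 ^ n) \<longlonglongrightarrow> 0" by real_asymp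
        then have "(\<lambda>n. min (?V 0 \<omega> / 2 ^ n) (real N)) \<longlonglongrightarrow> min 0 (real N)"
          by (intro tendsto_intros)
        then show "(\<lambda>n. min (?V 0 \<omega> / 2 ^ n) (real N)) \<longlonglongrightarrow> 0" by simp
      qed
    qed auto
    then have "(\<lambda>n. expectation (\<lambda>\<omega>. min (?V 0 \<omega> / 2 ^ n) (real N)) + B) \<longlonglongrightarrow> 0 + B"
      by (intro tendsto_intros) simp
    then show ?thesis
      using trunc_step[of N] by (intro LIMSEQ_le_const[of _ "0 + B", simplified]) auto
  qed
  have "(\<integral>\<^sup>+\<omega>. ennreal (?V 0 \<omega>) \<partial>M) \<le> (\<integral>\<^sup>+\<omega>. (SUP N. ennreal (min (?V 0 \<omega>) (real N))) \<partial>M)"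
  proof (rule nn_integral_mono)
    fix \<omega>
    obtain N :: nat where "?V 0 \<omega> \<le> real N" using real_arch_simple by blast
    then have "ennreal (?V 0 \<omega>) = ennreal (min (?V 0 \<omega>) (real N))" by simp
    then show "ennreal (?V 0 \<omega>) \<le> (SUP N. ennreal (min (?V 0 \<omega>) (real N)))"
      by (metis SUP_upper UNIV_I)
  qed
  also have "\<dots> = (SUP N. \<integral>\<^sup>+\<omega>. ennreal (min (?V 0 \<omega>) (real N)) \<partial>M)"
    by (rule nn_integral_monotone_convergence_SUP) (auto simp: incseq_def le_fun_def intro!: ennreal_leI)
  also have "\<dots> \<le> ennreal B"
  proof (rule SUP_least)
    fix N
    have "(\<integral>\<^sup>+\<omega>. ennreal (min (?V 0 \<omega>) (real N)) \<partial>M) = ennreal (expectation (\<lambda>\<omega>. min (?V 0 \<omega>) (real N)))"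
      using trunc_int[of 0 0 N] by (intro nn_integral_eq_integral) auto
    also have "\<dots> \<le> ennreal B" by (intro ennreal_leI trunc_bound)
    finally show "(\<integral>\<^sup>+\<omega>. ennreal (min (?V 0 \<omega>) (real N)) \<partial>M) \<le> ennreal B" .
  qed
  finally have "(\<integral>\<^sup>+\<omega>. ennreal (?V 0 \<omega>) \<partial>M) < \<infinity>" by (auto simp: top_unique less_top[symmetric])
  then show ?thesis by (intro integrableI_bounded) auto
qed

lemma \<xi>_norm_square:
  shows \<xi>_norm_square_integrable: "integrable M (\<lambda>\<omega>. (norm (\<xi> s \<omega>))\<^sup>2)"
    and \<xi>_norm_square_expectation: "expectation (\<lambda>\<omega>. (norm (\<xi> s \<omega>))\<^sup>2) = expectation (\<lambda>\<omega>. (norm (\<xi> 0 \<omega>))\<^sup>2)"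
  using stationary_expectation_single[of "\<lambda>x. (norm x)\<^sup>2" s] \<xi>_norm_square_integrable_0 by simp_all

lemma \<xi>_component_square:
  shows \<xi>_component_square_integrable: "integrable M (\<lambda>\<omega>. (\<xi> s \<omega> $ i)\<^sup>2)"
    and \<xi>_component_square_le:
      "expectation (\<lambda>\<omega>. (\<xi> s \<omega> $ i)\<^sup>2) \<le> expectation (\<lambda>\<omega>. (norm (\<xi> 0 \<omega>))\<^sup>2)"
proof -
  have le: "(\<xi> s \<omega> $ i)\<^sup>2 \<le> (norm (\<xi> s \<omega>))\<^sup>2" for \<omega>
    using component_le_norm_cart[of "\<xi> s \<omega>" i] by (metis abs_ge_zero power2_abs power_mono)
  show int: "integrable M (\<lambda>\<omega>. (\<xi> s \<omega> $ i)\<^sup>2)"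
    by (rule Bochner_Integration.integrable_bound[OF \<xi>_norm_square_integrable[of s]])
       (use le in \<open>auto intro!: AE_I2\<close>)
  show "expectation (\<lambda>\<omega>. (\<xi> s \<omega> $ i)\<^sup>2) \<le> expectation (\<lambda>\<omega>. (norm (\<xi> 0 \<omega>))\<^sup>2)"
    unfolding \<xi>_norm_square_expectation[of s, symmetric]
    by (intro integral_mono int \<xi>_norm_square_integrable le)
qed

lemma \<xi>_component_integrable: "integrable M (\<lambda>\<omega>. \<xi> s \<omega> $ i)"
  by (rule square_integrable_imp_integrable) (auto intro: \<xi>_component_square_integrable)

end

section \<open>The long-run covariance\<close>

context stable_ou_process
begin

lemma sde_component:
  assumes "s \<le> u"
  shows "AE \<omega> in M. \<xi> u \<omega> $ j = \<xi> s \<omega> $ j + (\<Sum>l\<in>UNIV. A $ j $ l * integral {s..u} (\<lambda>r. \<xi> r \<omega> $ l))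
    + \<sigma> * (W u \<omega> - W s \<omega>) $ j"
  using \<xi>_sde AE_space
proof eventually_elim
  fix \<omega> assume sde: "\<forall>s u. s \<le> u \<longrightarrow> \<xi> u \<omega> - \<xi> s \<omega> =
        integral {s..u} (\<lambda>r. A *v \<xi> r \<omega>) + \<sigma> *\<^sub>R (W u \<omega> - W s \<omega>)" and \<omega>: "\<omega> \<in> space M"
  have int: "(\<lambda>r. \<xi> r \<omega>) integrable_on {s..u}"
    by (intro integrable_continuous_interval continuous_on_subset[OF \<xi>_continuous[OF \<omega>]]) auto
  have "integral {s..u} (\<lambda>r. A *v \<xi> r \<omega>) = A *v integral {s..u} (\<lambda>r. \<xi> r \<omega>)"
    using integral_linear[OF int matrix_vector_mul_bounded_linear[of A]] by (simp add: comp_def)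
  also have "\<dots> $ j = (\<Sum>l\<in>UNIV. A $ j $ l * integral {s..u} (\<lambda>r. \<xi> r \<omega>) $ l)"
    by (simp add: matrix_vector_mult_def)
  also have "\<dots> = (\<Sum>l\<in>UNIV. A $ j $ l * integral {s..u} (\<lambda>r. \<xi> r \<omega> $ l))"
    by (simp add: integral_component_eq_cart[OF int])
  moreover have "(\<xi> u \<omega> - \<xi> s \<omega>) $ j =
      (integral {s..u} (\<lambda>r. A *v \<xi> r \<omega>) + \<sigma> *\<^sub>R (W u \<omega> - W s \<omega>)) $ j"
    using sde[rule_format, OF assms] by (rule arg_cong)
  ultimately show "\<xi> u \<omega> $ j = \<xi> s \<omega> $ j + (\<Sum>l\<in>UNIV. A $ j $ l * integral {s..u} (\<lambda>r. \<xi> r \<omega> $ l))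
    + \<sigma> * (W u \<omega> - W s \<omega>) $ j"
    by simp
qed

text \<open>The source of all moment equations: the j-th coordinate of the integrated equation times
  Z, in expectation. It is used with Z equal to 1, to a coordinate of \<open>\<xi>\<close> at the
  left or right end, and to a Brownian increment. Z may look into the future, in which case the
  noise term survives.\<close>

lemma
  assumes Z: "Z \<in> borel_measurable M" and Z2: "integrable M (\<lambda>\<omega>. (Z \<omega>)\<^sup>2)" and su: "s \<le> u"
  shows cross_moment_integrable_on: "(\<lambda>r. expectation (\<lambda>\<omega>. Z \<omega> * \<xi> r \<omega> $ l)) integrable_on {s..u}"
    and cross_moment_equation:
      "expectation (\<lambda>\<omega>. Z \<omega> * \<xi> u \<omega> $ j) = expectation (\<lambda>\<omega>. Z \<omega> * \<xi> s \<omega> $ j) +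
       (\<Sum>l\<in>UNIV. A $ j $ l * integral {s..u} (\<lambda>r. expectation (\<lambda>\<omega>. Z \<omega> * \<xi> r \<omega> $ l))) +
       \<sigma> * expectation (\<lambda>\<omega>. Z \<omega> * (W u \<omega> - W s \<omega>) $ j)"
proof -
  note [measurable] = Z
  have X_meas: "(\<lambda>\<omega>. Z \<omega> * \<xi> r \<omega> $ l) \<in> borel_measurable M" for r l
    using Z \<xi>_component_measurable by (rule borel_measurable_times)
  have X_cont: "continuous_on UNIV (\<lambda>r. Z \<omega> * \<xi> r \<omega> $ l)" if "\<omega> \<in> space M" for \<omega> l
    by (intro continuous_on_mult continuous_on_const \<xi>_component_continuous that)
  have X_int: "integrable M (\<lambda>\<omega>. Z \<omega> * \<xi> r \<omega> $ l)" for r l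
    by (intro integrable_mult_of_squares Z Z2 \<xi>_component_square_integrable \<xi>_component_measurable)
  have X_bound: "expectation (\<lambda>\<omega>. \<bar>Z \<omega> * \<xi> r \<omega> $ l\<bar>) \<le>
      expectation (\<lambda>\<omega>. (Z \<omega>)\<^sup>2) + expectation (\<lambda>\<omega>. (norm (\<xi> 0 \<omega>))\<^sup>2)" for r l
    using integrable_mult_of_squares(2)[OF Z \<xi>_component_measurable Z2 \<xi>_component_square_integrable, of r l]
      \<xi>_component_square_le[of r l] by linarith
  have path: "integrable M (\<lambda>\<omega>. integral {s..u} (\<lambda>r. Z \<omega> * \<xi> r \<omega> $ l))"
    "expectation (\<lambda>\<omega>. integral {s..u} (\<lambda>r. Z \<omega> * \<xi> r \<omega> $ l)) =
      integral {s..u} (\<lambda>r. expectation (\<lambda>\<omega>. Z \<omega> * \<xi> r \<omega> $ l))" for l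
    by (rule expectation_path_integral[where X = "\<lambda>r \<omega>. Z \<omega> * \<xi> r \<omega> $ l",
          OF X_meas X_cont X_int X_bound], assumption)+
  show "(\<lambda>r. expectation (\<lambda>\<omega>. Z \<omega> * \<xi> r \<omega> $ l)) integrable_on {s..u}"
    by (rule integrable_on_expectation[OF X_meas X_cont X_int X_bound])
  let ?w = "\<lambda>\<omega>. (W u \<omega> - W s \<omega>) $ j"
  have w_int: "integrable M (\<lambda>\<omega>. Z \<omega> * ?w \<omega>)"
    by (intro integrable_mult_of_squares(1) Z Z2 increment_square_integrable su increment_component_measurable)
  have "expectation (\<lambda>\<omega>. Z \<omega> * \<xi> u \<omega> $ j) = expectation (\<lambda>\<omega>. Z \<omega> * \<xi> s \<omega> $ j +
      (\<Sum>l\<in>UNIV. A $ j $ l * integral {s..u} (\<lambda>r. Z \<omega> * \<xi> r \<omega> $ l)) + \<sigma> * (Z \<omega> * ?w \<omega>))"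
  proof (rule integral_cong_AE)
    show "AE \<omega> in M. Z \<omega> * \<xi> u \<omega> $ j = Z \<omega> * \<xi> s \<omega> $ j +
      (\<Sum>l\<in>UNIV. A $ j $ l * integral {s..u} (\<lambda>r. Z \<omega> * \<xi> r \<omega> $ l)) + \<sigma> * (Z \<omega> * ?w \<omega>)"
      using sde_component[OF su, of j]
    proof eventually_elim
      case (elim \<omega>)
      show ?case unfolding elim
        by (simp add: algebra_simps sum_distrib_left del: vector_minus_component)
    qed
    show "(\<lambda>\<omega>. Z \<omega> * \<xi> u \<omega> $ j) \<in> borel_measurable M" by (rule X_meas)
    have "(\<lambda>\<omega>. integral {s..u} (\<lambda>r. Z \<omega> * \<xi> r \<omega> $ l)) \<in> borel_measurable M" for l
      by (rule borel_measurable_integrable[OF path(1)])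
    moreover have "?w \<in> borel_measurable M" by (rule increment_component_measurable)
    ultimately show "(\<lambda>\<omega>. Z \<omega> * \<xi> s \<omega> $ j + (\<Sum>l\<in>UNIV. A $ j $ l * integral {s..u} (\<lambda>r. Z \<omega> * \<xi> r \<omega> $ l)) +
       \<sigma> * (Z \<omega> * ?w \<omega>)) \<in> borel_measurable M"
      by (intro borel_measurable_add borel_measurable_sum borel_measurable_times X_meas borel_measurable_const Z)
  qed
  also have "\<dots> = expectation (\<lambda>\<omega>. Z \<omega> * \<xi> s \<omega> $ j) +
      (\<Sum>l\<in>UNIV. A $ j $ l * expectation (\<lambda>\<omega>. integral {s..u} (\<lambda>r. Z \<omega> * \<xi> r \<omega> $ l))) +
      \<sigma> * expectation (\<lambda>\<omega>. Z \<omega> * ?w \<omega>)"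
    using X_int path(1) w_int by (simp del: vector_minus_component integral_mult_right integral_mult_left)
  finally show "expectation (\<lambda>\<omega>. Z \<omega> * \<xi> u \<omega> $ j) = expectation (\<lambda>\<omega>. Z \<omega> * \<xi> s \<omega> $ j) +
       (\<Sum>l\<in>UNIV. A $ j $ l * integral {s..u} (\<lambda>r. expectation (\<lambda>\<omega>. Z \<omega> * \<xi> r \<omega> $ l))) +
       \<sigma> * expectation (\<lambda>\<omega>. Z \<omega> * ?w \<omega>)"
    unfolding path(2) .
qed

text \<open>The mean is constant by stationarity, so its equation over [0, 1] reduces to A m =
  0.\<close>

lemma \<xi>_mean: "expectation (\<lambda>\<omega>. \<xi> s \<omega> $ i) = 0"
proof -
  define m where "m = (\<chi> j. expectation (\<lambda>\<omega>. \<xi> 0 \<omega> $ j))"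
  have mean: "expectation (\<lambda>\<omega>. \<xi> r \<omega> $ j) = m $ j" for r j
    unfolding m_def vec_lambda_beta by (rule stationary_expectation_single(1)[OF borel_measurable_nth])
  have "(A *v m) $ j = 0" for j
  proof -
    have noise: "expectation (\<lambda>\<omega>. 1 * (W 1 \<omega> - W 0 \<omega>) $ j) = 0"
      by (rule increment_independent_expectation) auto
    have "expectation (\<lambda>\<omega>. 1 * \<xi> 1 \<omega> $ j) = expectation (\<lambda>\<omega>. 1 * \<xi> 0 \<omega> $ j) +
       (\<Sum>l\<in>UNIV. A $ j $ l * integral {0..1} (\<lambda>r. expectation (\<lambda>\<omega>. 1 * \<xi> r \<omega> $ l))) +
       \<sigma> * expectation (\<lambda>\<omega>. 1 * (W 1 \<omega> - W 0 \<omega>) $ j)"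
      by (rule cross_moment_equation) auto
    then have "(\<Sum>l\<in>UNIV. A $ j $ l * m $ l) = 0"
      unfolding noise by (simp add: mean)
    then show ?thesis by (simp add: matrix_vector_mult_def)
  qed
  then have "A *v m = 0" by (simp add: vec_eq_iff)
  then have "m = 0" by (rule A_injective)
  then show ?thesis by (simp add: mean)
qed

text \<open>Row i of the covariance at lag \<open>\<tau>\<close>; centering is omitted since the
  mean vanishes. Cutting the matrix into rows makes each of them a solution of x' = A x.\<close>

definition autocov :: "real \<Rightarrow> 'n \<Rightarrow> real ^ 'n" where
  "autocov \<tau> i = (\<chi> j. expectation (\<lambda>\<omega>. \<xi> 0 \<omega> $ i * \<xi> \<tau> \<omega> $ j))"

text \<open>Column j, not row, of the expectation of \<open>\<xi>\<close> at \<open>\<tau>\<close>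
  times the transposed increment: it is the columns that evolve under A, here with constant forcing
  \<sigma> in direction j.\<close>

definition noise_cov :: "real \<Rightarrow> 'n \<Rightarrow> real ^ 'n" where
  "noise_cov \<tau> j = (\<chi> i. expectation (\<lambda>\<omega>. (W \<tau> \<omega> - W 0 \<omega>) $ j * \<xi> \<tau> \<omega> $ i))"

lemma autocov_shift: "expectation (\<lambda>\<omega>. \<xi> s \<omega> $ i * \<xi> u \<omega> $ j) = autocov (u - s) i $ j"
proof -
  have [measurable]: "(\<lambda>p :: (real ^ 'n) \<times> (real ^ 'n). fst p $ i * snd p $ j) \<in> borel_measurable (borel \<Otimes>\<^sub>M borel)"
    using measurable_compose[OF measurable_fst borel_measurable_nth[of i]]
      measurable_compose[OF measurable_snd borel_measurable_nth[of j]]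
    by (rule borel_measurable_times)
  show ?thesis
    using stationary_expectation(1)[of "\<lambda>p. fst p $ i * snd p $ j" 0 s "u - s"]
    by (simp add: autocov_def)
qed

lemma autocov_minus: "autocov (- \<tau>) i $ j = autocov \<tau> j $ i"
  using autocov_shift[of \<tau> i 0 j] by (simp add: autocov_def mult.commute)

text \<open>A regularity bootstrap: Fubini yields only integrability of the moment functions, but
  their primitives are continuous, hence by the equation so are the functions themselves. The matrix
  can then be moved under the integral.\<close>

lemma integral_equation_vector:
  fixes x b :: "real \<Rightarrow> real ^ 'n"
  assumes int: "\<And>T l. 0 \<le> T \<Longrightarrow> (\<lambda>r. x r $ l) integrable_on {0..T}"
    and eq: "\<And>T i. 0 \<le> T \<Longrightarrow> x T $ i = b T $ i + (\<Sum>l\<in>UNIV. A $ i $ l * integral {0..T} (\<lambda>r. x r $ l))"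
    and b: "continuous_on {0..} b"
  shows "continuous_on {0..} x"
    and "\<And>T. 0 \<le> T \<Longrightarrow> x T = b T + integral {0..T} (\<lambda>r. A *v x r)"
proof -
  have prim: "continuous_on {0..} (\<lambda>T. integral {0..T} (\<lambda>r. x r $ l))" for l
  proof -
    have "continuous (at T within {0..}) (\<lambda>T. integral {0..T} (\<lambda>r. x r $ l))" if "0 \<le> T" for T
    proof -
      have "continuous_on {0..T + 1} (\<lambda>T. integral {0..T} (\<lambda>r. x r $ l))"
        using that by (intro indefinite_integral_continuous_1 int) auto
      then have "continuous (at T within {0..T + 1}) (\<lambda>T. integral {0..T} (\<lambda>r. x r $ l))"
        using that by (auto simp: continuous_on_eq_continuous_within)
      moreover have "at T within {0..T + 1} = at T within {0..}"
        by (rule at_within_nhd[of T "{..<T + 1}", symmetric]) auto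
      ultimately show ?thesis by simp
    qed
    then show "continuous_on {0..} (\<lambda>T. integral {0..T} (\<lambda>r. x r $ l))"
      by (auto simp: continuous_on_eq_continuous_within)
  qed
  have "continuous_on {0..} (\<lambda>T. \<chi> i. b T $ i + (\<Sum>l\<in>UNIV. A $ i $ l * integral {0..T} (\<lambda>r. x r $ l)))"
    by (intro continuous_intros b prim)
  then show cont: "continuous_on {0..} x"
    by (rule continuous_on_eq) (simp add: vec_eq_iff eq)
  fix T :: real assume T: "0 \<le> T"
  have xint: "x integrable_on {0..T}"
    by (intro integrable_continuous_interval continuous_on_subset[OF cont]) auto
  have "integral {0..T} (\<lambda>r. A *v x r) = A *v integral {0..T} x"
    using integral_linear[OF xint matrix_vector_mul_bounded_linear[of A]] by (simp add: comp_def)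
  then show "x T = b T + integral {0..T} (\<lambda>r. A *v x r)"
    using T by (simp add: vec_eq_iff eq matrix_vector_mult_def integral_component_eq_cart[OF xint])
qed

lemma autocov_integral_equation:
  shows autocov_continuous: "continuous_on {0..} (\<lambda>\<tau>. autocov \<tau> i)"
    and autocov_equation: "\<And>T. 0 \<le> T \<Longrightarrow> autocov T i = autocov 0 i + integral {0..T} (\<lambda>r. A *v autocov r i)"
proof -
  have int: "(\<lambda>r. autocov r i $ l) integrable_on {0..T}" if "0 \<le> T" for T l
    using cross_moment_integrable_on[OF \<xi>_component_measurable \<xi>_component_square_integrable that, of 0 i l]
    by (simp add: autocov_def)
  have eq: "autocov T i $ j = autocov 0 i $ j + (\<Sum>l\<in>UNIV. A $ j $ l * integral {0..T} (\<lambda>r. autocov r i $ l))"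
    if T: "0 \<le> T" for T j
  proof -
    \<comment> \<open>Adaptedness at time 0 kills the noise term, so the equation for positive lags
      is homogeneous.\<close>
    have Z: "(\<lambda>\<omega>. \<xi> 0 \<omega> $ i) \<in> borel_measurable (F 0)"
      by (rule measurable_compose[OF \<xi>_adapted borel_measurable_nth])
    show ?thesis
      using cross_moment_equation[OF \<xi>_component_measurable \<xi>_component_square_integrable T, of 0 i j]
      unfolding increment_independent_expectation[OF T Z \<xi>_component_integrable]
      by (simp add: autocov_def)
  qed
  show "continuous_on {0..} (\<lambda>\<tau>. autocov \<tau> i)"
    and "\<And>T. 0 \<le> T \<Longrightarrow> autocov T i = autocov 0 i + integral {0..T} (\<lambda>r. A *v autocov r i)"
    by (rule integral_equation_vector[of "\<lambda>\<tau>. autocov \<tau> i" "\<lambda>_. autocov 0 i"]; (rule int eq)?; simp)+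
qed

lemmas autocov_tendsto_0 = flow_tendsto_0[where x = "\<lambda>\<tau>. autocov \<tau> i" for i, OF autocov_equation autocov_continuous]
  and autocov_set_integrable = flow_set_integrable[where x = "\<lambda>\<tau>. autocov \<tau> i" for i, OF autocov_equation autocov_continuous]
  and autocov_integral = flow_integral[where x = "\<lambda>\<tau>. autocov \<tau> i" for i, OF autocov_equation autocov_continuous]

text \<open>The increment after time r is independent of \<open>\<xi> r\<close>. This closes the
  equation for \<open>noise_cov\<close>: the multiplier depends on the final time T, but under the
  integral over r only its part up to r counts.\<close>

lemma noise_cov_later:
  assumes "0 \<le> r" "r \<le> T"
  shows "expectation (\<lambda>\<omega>. (W T \<omega> - W 0 \<omega>) $ j * \<xi> r \<omega> $ l) = noise_cov r j $ l"
proof -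
  have T: "0 \<le> T" using assms by simp
  have Z: "(\<lambda>\<omega>. \<xi> r \<omega> $ l) \<in> borel_measurable (F r)"
    by (rule measurable_compose[OF \<xi>_adapted borel_measurable_nth])
  have int: "integrable M (\<lambda>\<omega>. (W u \<omega> - W s \<omega>) $ j * \<xi> r \<omega> $ l)" if "s \<le> u" for s u
    by (intro integrable_mult_of_squares(1) increment_component_measurable \<xi>_component_measurable
        increment_square_integrable \<xi>_component_square_integrable that)
  have "expectation (\<lambda>\<omega>. (W T \<omega> - W 0 \<omega>) $ j * \<xi> r \<omega> $ l) =
      expectation (\<lambda>\<omega>. (W r \<omega> - W 0 \<omega>) $ j * \<xi> r \<omega> $ l + (W T \<omega> - W r \<omega>) $ j * \<xi> r \<omega> $ l)"
    by (simp add: algebra_simps)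
  also have "\<dots> = expectation (\<lambda>\<omega>. (W r \<omega> - W 0 \<omega>) $ j * \<xi> r \<omega> $ l) +
      expectation (\<lambda>\<omega>. (W T \<omega> - W r \<omega>) $ j * \<xi> r \<omega> $ l)"
    by (intro Bochner_Integration.integral_add int assms)
  also have "expectation (\<lambda>\<omega>. (W T \<omega> - W r \<omega>) $ j * \<xi> r \<omega> $ l) = 0"
    using increment_independent_expectation[OF assms(2) Z \<xi>_component_integrable, of j]
    by (simp add: mult.commute del: vector_minus_component)
  finally show ?thesis by (simp add: noise_cov_def del: vector_minus_component)
qed

lemma noise_cov_integral_equation:
  shows noise_cov_continuous: "continuous_on {0..} (\<lambda>\<tau>. noise_cov \<tau> j)"
    and noise_cov_equation: "\<And>T. 0 \<le> T \<Longrightarrow>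
      noise_cov T j = axis j (\<sigma> * T) + integral {0..T} (\<lambda>r. A *v noise_cov r j)"
proof -
  have W_meas: "(\<lambda>\<omega>. (W T \<omega> - W 0 \<omega>) $ j) \<in> borel_measurable M" for T
    by (rule increment_component_measurable)
  have int: "(\<lambda>r. noise_cov r j $ l) integrable_on {0..T}" if "0 \<le> T" for T l
    using cross_moment_integrable_on[OF W_meas increment_square_integrable[OF that] that, of l]
    by (rule integrable_eq) (simp add: noise_cov_later del: vector_minus_component)
  have eq: "noise_cov T j $ i = axis j (\<sigma> * T) $ i + (\<Sum>l\<in>UNIV. A $ i $ l * integral {0..T} (\<lambda>r. noise_cov r j $ l))"
    if T: "0 \<le> T" for T i
  proof -
    have "integral {0..T} (\<lambda>r. expectation (\<lambda>\<omega>. (W T \<omega> - W 0 \<omega>) $ j * \<xi> r \<omega> $ l)) =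
        integral {0..T} (\<lambda>r. noise_cov r j $ l)" for l
      by (rule integral_cong) (simp add: noise_cov_later del: vector_minus_component)
    moreover have "expectation (\<lambda>\<omega>. (W T \<omega> - W 0 \<omega>) $ j * \<xi> 0 \<omega> $ i) = 0"
      using noise_cov_later[of 0 T j i] T by (simp add: noise_cov_def)
    \<comment> \<open>Here the increment is correlated with itself, which is the origin of the
      forcing term.\<close>
    moreover have "\<sigma> * (if j = i then T - 0 else 0) = axis j (\<sigma> * T) $ i"
      by (simp add: axis_def)
    ultimately show ?thesis
      using cross_moment_equation[OF W_meas increment_square_integrable[OF T] T, of i]
      unfolding increment_product_moment[OF T]
      by (simp add: noise_cov_later[OF T] del: vector_minus_component)
  qed
  have b: "continuous_on {0..} (\<lambda>T. axis j (\<sigma> * T))"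
  proof -
    have "continuous_on {0..} (\<lambda>T. if i = j then \<sigma> * T else 0)" for i
      by (cases "i = j") (auto intro!: continuous_intros)
    then show ?thesis unfolding axis_def by (intro continuous_on_vec_lambda)
  qed
  show "continuous_on {0..} (\<lambda>\<tau>. noise_cov \<tau> j)"
    and "\<And>T. 0 \<le> T \<Longrightarrow> noise_cov T j = axis j (\<sigma> * T) + integral {0..T} (\<lambda>r. A *v noise_cov r j)"
    by (rule integral_equation_vector[of "\<lambda>\<tau>. noise_cov \<tau> j" "\<lambda>T. axis j (\<sigma> * T)"]; (rule int eq b)?; simp)+
qed

text \<open>The vector -v is the equilibrium of g' = A g + A v with A v =
  \<open>axis j \<sigma>\<close>; after the shift by v the equation is homogeneous and the solution
  decays to 0.\<close>

lemma noise_cov_limit: "((\<lambda>T. A *v noise_cov T j) \<longlongrightarrow> - axis j \<sigma>) at_top"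
proof -
  obtain v where v: "A *v v = axis j \<sigma>"
    using A_invertible by (metis invertible_def matrix_vector_mul_assoc matrix_vector_mul_lid)
  define x where "x T = noise_cov T j + v" for T
  have cont: "continuous_on {0..} x"
    unfolding x_def by (intro continuous_intros noise_cov_continuous)
  have x: "x T = x 0 + integral {0..T} (\<lambda>r. A *v x r)" if T: "0 \<le> T" for T
  proof -
    have int: "(\<lambda>r. A *v noise_cov r j) integrable_on {0..T}"
      by (intro integrable_continuous_interval bounded_linear.continuous_on[OF matrix_vector_mul_bounded_linear]
          continuous_on_subset[OF noise_cov_continuous]) auto
    have "integral {0..T} (\<lambda>r. A *v x r) = integral {0..T} (\<lambda>r. A *v noise_cov r j) + T *\<^sub>R axis j \<sigma>"
      unfolding x_def matrix_vector_right_distrib v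
      using T by (subst Henstock_Kurzweil_Integration.integral_add[OF int]) auto
    moreover have "T *\<^sub>R axis j \<sigma> = axis j (\<sigma> * T)" by (simp add: axis_def vec_eq_iff)
    moreover have "noise_cov 0 j = 0" by (simp add: noise_cov_def vec_eq_iff)
    ultimately show ?thesis using noise_cov_equation[OF T, of j] by (simp add: x_def)
  qed
  have "((\<lambda>T. A *v x T - axis j \<sigma>) \<longlongrightarrow> A *v 0 - axis j \<sigma>) at_top"
    by (intro tendsto_intros bounded_linear.tendsto[OF matrix_vector_mul_bounded_linear]
        flow_tendsto_0[OF x cont])
  then show ?thesis by (simp add: x_def matrix_vector_right_distrib v)
qed

definition half_integral :: "real ^ 'n ^ 'n" where
  "half_integral = (\<chi> i. LINT \<tau>:{0..}|lborel. autocov \<tau> i)"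

lemma A_half_integral: "A *v (half_integral $ i) = - autocov 0 i"
  using autocov_integral[of i] by (simp add: half_integral_def)

text \<open>The moment equation over [0, T] with \<open>\<xi> T\<close> as multiplier. It looks
  ahead of the noise, so \<open>noise_cov\<close> appears; stationarity makes the left side
  independent of T.\<close>

lemma stationary_second_moment_equation:
  assumes T: "0 \<le> T"
  shows "autocov 0 i $ j = autocov T j $ i +
    (\<Sum>l\<in>UNIV. A $ j $ l * integral {0..T} (\<lambda>r. autocov r l $ i)) + \<sigma> * noise_cov T j $ i"
proof -
  have "integral {0..T} (\<lambda>r. expectation (\<lambda>\<omega>. \<xi> T \<omega> $ i * \<xi> r \<omega> $ l)) =
      integral {0..T} (\<lambda>r. autocov r l $ i)" for l
  proof -
    have "integral {0..T} (\<lambda>r. expectation (\<lambda>\<omega>. \<xi> T \<omega> $ i * \<xi> r \<omega> $ l)) =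
        integral {0..T} (\<lambda>r. autocov (T - r) l $ i)"
      using autocov_minus[of "T - r" i l for r] by (simp add: autocov_shift)
    also have "\<dots> = integral {0..T} (\<lambda>r. autocov r l $ i)"
    proof -
      \<comment> \<open>Time reversal r -> T - r turns distance from the right end into the
        lag.\<close>
      have "((\<lambda>r. autocov r l $ i) has_integral integral {0..T} (\<lambda>r. autocov r l $ i)) (cbox 0 T)"
        using cross_moment_integrable_on[OF \<xi>_component_measurable \<xi>_component_square_integrable T, of 0 l i]
        by (simp add: autocov_def integrable_integral)
      from has_integral_affinity[OF this, of "-1" T] T show ?thesis
        by (intro integral_unique) (simp add: image_affinity_atLeastAtMost_diff)
    qed
    finally show ?thesis .
  qed
  then show ?thesis
    using cross_moment_equation[OF \<xi>_component_measurable \<xi>_component_square_integrable T, of T i j]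
    by (simp add: autocov_shift noise_cov_def mult.commute autocov_minus del: vector_minus_component)
qed

text \<open>With \<open>J\<close> the integral of the autocovariance over the positive half-line and \<open>\<Sigma> = - J A\<^sup>T\<close>
  the stationary covariance, letting the time horizon tend to infinity in
  \<open>E (\<xi>\<^sub>T \<xi>\<^sub>T\<^sup>T) = \<Sigma>\<close> gives \<open>A (J + J\<^sup>T) A\<^sup>T = \<sigma>\<^sup>2 I\<close>.\<close>
lemma half_integral_equation:
  "A ** (half_integral + transpose half_integral) ** transpose A = mat (\<sigma>\<^sup>2)"
proof -
  let ?J = half_integral
  define \<Sigma> :: "real ^ 'n ^ 'n" where "\<Sigma> = (\<chi> i. autocov 0 i)"
  define G where "G T = (\<chi> i j. noise_cov T j $ i)" for T
  have \<Sigma>_sym: "transpose \<Sigma> = \<Sigma>"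
    using autocov_minus[of 0] by (simp add: \<Sigma>_def transpose_def vec_eq_iff)
  have "?J ** transpose A = - \<Sigma>"
  proof -
    have "(?J ** transpose A) $ i $ j = (A *v (?J $ i)) $ j" for i j
      by (simp add: matrix_matrix_mult_def matrix_vector_mult_def transpose_def mult.commute)
    then show ?thesis by (simp add: vec_eq_iff A_half_integral \<Sigma>_def)
  qed
  then have J\<Sigma>: "A ** transpose ?J = - \<Sigma>"
    using \<Sigma>_sym matrix_transpose_mul[of ?J "transpose A"]
    by (simp add: transpose_def vec_eq_iff)
  have G_lim: "((\<lambda>T. A ** G T) \<longlongrightarrow> - mat \<sigma>) at_top"
  proof (rule vec_tendstoI, rule vec_tendstoI)
    fix i j
    have "((\<lambda>T. (A *v noise_cov T j) $ i) \<longlongrightarrow> (- axis j \<sigma>) $ i) at_top"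
      by (intro tendsto_vec_nth noise_cov_limit)
    moreover have "(- axis j \<sigma>) $ i = (- mat \<sigma> :: real ^ 'n ^ 'n) $ i $ j"
      by (simp add: axis_def mat_def)
    moreover have "(A *v noise_cov T j) $ i = (A ** G T) $ i $ j" for T
      by (simp add: G_def matrix_matrix_mult_def matrix_vector_mult_def)
    ultimately show "((\<lambda>T. (A ** G T) $ i $ j) \<longlongrightarrow> (- mat \<sigma> :: real ^ 'n ^ 'n) $ i $ j) at_top"
      by simp
  qed
  \<comment> \<open>\<open>R\<close> gathers everything but the noise term of the second moment
    identity, hence equals \<sigma> G. Its limit comes from the decay and the half-line integrals of
    the autocovariance, that of G from the noise equation.\<close>
  define R where "R T = \<Sigma> - (\<chi> i j. autocov T j $ i) - (\<chi> i j. (\<Sum>l\<in>UNIV. A $ j $ l * integral {0..T} (\<lambda>r. autocov r l $ i)))" for T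
  have R_eq: "R T = \<sigma> *\<^sub>R G T" if "0 \<le> T" for T
    unfolding vec_eq_iff
    using stationary_second_moment_equation[OF that] by (simp add: R_def G_def \<Sigma>_def)
  have R_lim: "(R \<longlongrightarrow> \<Sigma> - transpose ?J ** transpose A) at_top"
  proof (rule vec_tendstoI, rule vec_tendstoI)
    fix i j
    have int: "((\<lambda>T. integral {0..T} (\<lambda>r. autocov r l $ i)) \<longlongrightarrow> ?J $ l $ i) at_top" for l
    proof -
      have "((\<lambda>T. integral {0..T} (\<lambda>r. autocov r l) $ i) \<longlongrightarrow> ?J $ l $ i) at_top"
        unfolding half_integral_def vec_lambda_beta
        by (intro tendsto_vec_nth tendsto_integral_Icc_at_top autocov_set_integrable)
      moreover have "integral {0..T} (\<lambda>r. autocov r l) $ i = integral {0..T} (\<lambda>r. autocov r l $ i)" for T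
        by (intro integral_component_eq_cart[symmetric] integrable_continuous_interval
            continuous_on_subset[OF autocov_continuous]) auto
      ultimately show ?thesis by simp
    qed
    have "((\<lambda>T. \<Sigma> $ i $ j - autocov T j $ i - (\<Sum>l\<in>UNIV. A $ j $ l * integral {0..T} (\<lambda>r. autocov r l $ i)))
        \<longlongrightarrow> \<Sigma> $ i $ j - 0 $ i - (\<Sum>l\<in>UNIV. A $ j $ l * ?J $ l $ i)) at_top"
      by (intro tendsto_intros tendsto_vec_nth autocov_tendsto_0 int)
    then show "((\<lambda>T. R T $ i $ j) \<longlongrightarrow> (\<Sigma> - transpose ?J ** transpose A) $ i $ j) at_top"
      by (simp add: R_def matrix_matrix_mult_def transpose_def mult.commute)
  qed
  \<comment> \<open>The limit is known for \<open>A ** G T\<close> rather than for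
    \<open>G T\<close>, so \<open>R\<close> is multiplied by A before the two limits are
    compared.\<close>
  have mult_lim: "((\<lambda>T. A ** R T) \<longlongrightarrow> A ** (\<Sigma> - transpose ?J ** transpose A)) at_top"
    unfolding matrix_matrix_mult_def[of A]
    by (intro tendsto_vec_lambda tendsto_sum tendsto_mult tendsto_const tendsto_vec_nth R_lim)
  have "((\<lambda>T. \<sigma> *\<^sub>R (A ** G T)) \<longlongrightarrow> \<sigma> *\<^sub>R (- mat \<sigma>)) at_top"
    by (intro tendsto_intros G_lim)
  moreover have "\<forall>\<^sub>F T in at_top. \<sigma> *\<^sub>R (A ** G T) = A ** R T"
    using eventually_ge_at_top[of 0]
  proof eventually_elim
    case (elim T)
    then show ?case
      by (simp add: R_eq matrix_matrix_mult_def vec_eq_iff sum_distrib_left mult.left_commute)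
  qed
  ultimately have "((\<lambda>T. A ** R T) \<longlongrightarrow> \<sigma> *\<^sub>R (- mat \<sigma>)) at_top"
    by (rule Lim_transform_eventually)
  then have "A ** (\<Sigma> - transpose ?J ** transpose A) = \<sigma> *\<^sub>R (- mat \<sigma>)"
    using mult_lim tendsto_unique[OF trivial_limit_at_top_linorder] by blast
  moreover have "\<Sigma> - transpose ?J ** transpose A = - ((?J + transpose ?J) ** transpose A)"
  proof -
    have "(?J + transpose ?J) ** transpose A = ?J ** transpose A + transpose ?J ** transpose A"
      by (simp add: matrix_matrix_mult_def vec_eq_iff sum.distrib distrib_right)
    then show ?thesis using \<open>?J ** transpose A = - \<Sigma>\<close> by simp
  qed
  ultimately have limit: "A ** (- ((?J + transpose ?J) ** transpose A)) = \<sigma> *\<^sub>R (- mat \<sigma>)" by simp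
  have "- (A ** (?J + transpose ?J) ** transpose A) = \<sigma> *\<^sub>R (- mat \<sigma>)"
  proof -
    have "A ** (- X) = - (A ** X)" for X :: "real ^ 'n ^ 'n"
      by (simp add: matrix_matrix_mult_def vec_eq_iff sum_negf)
    with limit show ?thesis
      by (simp only: matrix_mul_assoc)
  qed
  moreover have "\<sigma> *\<^sub>R (mat \<sigma> :: real ^ 'n ^ 'n) = mat (\<sigma>\<^sup>2)"
    by (simp add: mat_def vec_eq_iff power2_eq_square)
  ultimately show ?thesis by (metis add.inverse_inverse scaleR_minus_right)
qed

text \<open>Negative lags are reflected to positive ones, which transposes the covariance; the two
  half-lines overlap only in the null set {0}.\<close>

lemma autocov_has_bochner_integral:
  "has_bochner_integral lborel (\<lambda>\<tau>. autocov \<tau> i $ j) (half_integral $ i $ j + half_integral $ j $ i)"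
proof -
  have half: "has_bochner_integral lborel (\<lambda>\<tau>. indicator {0..} \<tau> * autocov \<tau> i $ j) (half_integral $ i $ j)" for i j
    using integrable_bounded_linear[OF bounded_linear_vec_nth autocov_set_integrable[of i, unfolded set_integrable_def], of j]
      integral_bounded_linear[OF bounded_linear_vec_nth autocov_set_integrable[of i, unfolded set_integrable_def], of j]
    by (simp add: has_bochner_integral_iff half_integral_def set_lebesgue_integral_def)
  have "has_bochner_integral lborel (\<lambda>\<tau>. indicator {0..} (0 + (- 1) * \<tau>) * autocov (0 + (- 1) * \<tau>) j $ i)
      (half_integral $ j $ i /\<^sub>R \<bar>- 1\<bar>)"
    by (subst lborel_has_bochner_integral_real_affine_iff[symmetric]) (auto intro: half)
  then have "has_bochner_integral lborel (\<lambda>\<tau>. indicator {0..} (- \<tau>) * autocov \<tau> i $ j) (half_integral $ j $ i)"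
    by (simp add: autocov_minus)
  from has_bochner_integral_add[OF half[of i j] this]
  have *: "has_bochner_integral lborel (\<lambda>\<tau>. indicator {0..} \<tau> * autocov \<tau> i $ j + indicator {0..} (- \<tau>) * autocov \<tau> i $ j)
      (half_integral $ i $ j + half_integral $ j $ i)" .
  have ae: "AE \<tau> in lborel. indicator {0..} \<tau> * autocov \<tau> i $ j + indicator {0..} (- \<tau>) * autocov \<tau> i $ j = autocov \<tau> i $ j"
    using AE_lborel_singleton[of "0::real"] by eventually_elim (auto simp: indicator_def)
  \<comment> \<open>\<open>lborel\<close> is not complete, so measurability cannot be inferred from
    equality almost everywhere. The function is rebuilt exactly, with its value at 0 as a separate
    case.\<close>
  have meas: "(\<lambda>\<tau>. autocov \<tau> i $ j) \<in> borel_measurable lborel"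
  proof -
    have "(\<lambda>\<tau>. if \<tau> = 0 then autocov 0 i $ j else
        indicator {0..} \<tau> * autocov \<tau> i $ j + indicator {0..} (- \<tau>) * autocov \<tau> i $ j) \<in> borel_measurable lborel"
      using has_bochner_integral_integrable borel_measurable_has_bochner_integral[OF *] by simp
    also have "(\<lambda>\<tau>. if \<tau> = 0 then autocov 0 i $ j else
        indicator {0..} \<tau> * autocov \<tau> i $ j + indicator {0..} (- \<tau>) * autocov \<tau> i $ j) = (\<lambda>\<tau>. autocov \<tau> i $ j)"
      by (auto simp: indicator_def)
    finally show ?thesis .
  qed
  show ?thesis
    by (rule has_bochner_integral_cong_AE[THEN iffD1, OF _ meas ae *])
       (rule borel_measurable_has_bochner_integral[OF *])
qed

lemma covariance_matrix_eq_autocov: "covariance_matrix M (\<xi> 0) (\<xi> \<tau>) = (\<chi> i. autocov \<tau> i)"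
  by (simp add: covariance_matrix_def autocov_def \<xi>_mean vec_eq_iff)

text \<open>Entries can be taken out of a Bochner integral once integrability is known, hence the
  two preliminary facts, for the matrix and for its rows.\<close>

lemma long_run_covariance_eq: "long_run_covariance M \<xi> = half_integral + transpose half_integral"
proof -
  have int: "integrable lborel (\<lambda>\<tau>. \<chi> i. autocov \<tau> i)"
    using autocov_has_bochner_integral by (intro integrable_vecI) (auto simp: has_bochner_integral_iff)
  have row: "integrable lborel (\<lambda>\<tau>. autocov \<tau> i)" for i
    using autocov_has_bochner_integral by (intro integrable_vecI) (auto simp: has_bochner_integral_iff)
  have "(\<integral>\<tau>. (\<chi> i. autocov \<tau> i) \<partial>lborel) $ i $ j = half_integral $ i $ j + half_integral $ j $ i" for i j
    using autocov_has_bochner_integral[of i j]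
    by (simp add: integral_vec_nth[OF int] integral_vec_nth[OF row] has_bochner_integral_iff)
  then show ?thesis
    unfolding long_run_covariance_def covariance_matrix_eq_autocov
    by (simp add: vec_eq_iff transpose_def)
qed

text \<open>From A S A^T = \<sigma>^2 I a right inverse of A is read off. For square matrices it is
  also a left inverse, which allows A to be moved cyclically to the other end of the
  product.\<close>

lemma matrix_inv_long_run_covariance:
  "matrix_inv (long_run_covariance M \<xi>) = (1 / \<sigma>\<^sup>2) *\<^sub>R (transpose A ** A)"
proof -
  let ?S = "long_run_covariance M \<xi>"
  have scale: "(r *\<^sub>R X) ** Y = r *\<^sub>R (X ** Y)" "X ** (r *\<^sub>R Y) = r *\<^sub>R (X ** Y)" for r :: real and X Y :: "real ^ 'n ^ 'n"
    by (simp_all add: matrix_matrix_mult_def vec_eq_iff sum_distrib_left mult_ac)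
  have "A ** ((1 / \<sigma>\<^sup>2) *\<^sub>R (?S ** transpose A)) = (1 / \<sigma>\<^sup>2) *\<^sub>R mat (\<sigma>\<^sup>2)"
    using half_integral_equation by (simp add: scale long_run_covariance_eq matrix_mul_assoc)
  also have "\<dots> = mat 1"
    using \<sigma>_pos by (simp add: mat_def vec_eq_iff)
  finally have "((1 / \<sigma>\<^sup>2) *\<^sub>R (?S ** transpose A)) ** A = mat 1"
    using matrix_left_right_inverse by blast
  then have right: "?S ** ((1 / \<sigma>\<^sup>2) *\<^sub>R (transpose A ** A)) = mat 1"
    by (simp add: scale matrix_mul_assoc)
  then have left: "((1 / \<sigma>\<^sup>2) *\<^sub>R (transpose A ** A)) ** ?S = mat 1"
    using matrix_left_right_inverse by blast
  have "?S ** matrix_inv ?S = mat 1"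
    unfolding matrix_inv_def using right left by (metis (mono_tags, lifting) someI_ex)
  then show ?thesis
    using left by (metis matrix_mul_assoc matrix_mul_lid matrix_mul_rid)
qed

end

section \<open>The limit law of the detection statistic\<close>

text \<open>A Slutsky argument for tails: up to an event of vanishing probability, the tail of N at
  r lies between those of Z at r + \<delta> and r - \<delta>. A union bound suffices, so N, Z and R
  may be dependent.\<close>

lemma (in prob_space) tail_prob_tendsto_perturbed:
  fixes N Z R :: "real \<Rightarrow> 'a \<Rightarrow> real" and H :: "real \<Rightarrow> real"
  assumes meas [measurable]: "\<And>T. N T \<in> borel_measurable M" "\<And>T. Z T \<in> borel_measurable M"
      "\<And>T. R T \<in> borel_measurable M"
    and close: "\<And>T \<omega>. T > 0 \<Longrightarrow> \<bar>N T \<omega> - Z T \<omega>\<bar> \<le> R T \<omega>"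
    and tail: "\<And>T x. T > 0 \<Longrightarrow> x > 0 \<Longrightarrow> prob {\<omega> \<in> space M. x \<le> Z T \<omega>} = H x"
    and small: "\<And>\<delta>. \<delta> > 0 \<Longrightarrow> ((\<lambda>T. prob {\<omega> \<in> space M. \<delta> \<le> R T \<omega>}) \<longlongrightarrow> 0) at_top"
    and r: "r > 0" and H: "isCont H r"
  shows "((\<lambda>T. prob {\<omega> \<in> space M. r \<le> N T \<omega>}) \<longlongrightarrow> H r) at_top"
proof (rule tendstoI)
  fix e :: real assume e: "e > 0"
  from H have "\<forall>e>0. \<exists>d>0. \<forall>x. dist x r < d \<longrightarrow> dist (H x) (H r) < e"
    by (simp add: continuous_at_eps_delta dist_norm)
  then obtain d where d: "d > 0" and Hd: "\<And>x. dist x r < d \<Longrightarrow> dist (H x) (H r) < e / 2"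
    using e by (meson half_gt_zero)
  \<comment> \<open>Below d for the continuity of H, and below r so that r - \<delta> stays in the
    range where the tail of Z is given.\<close>
  define \<delta> where "\<delta> = min (d / 2) (r / 2)"
  have \<delta>: "\<delta> > 0" "\<delta> < d" "\<delta> < r" using d r by (auto simp: \<delta>_def)
  have "\<forall>\<^sub>F T in at_top. prob {\<omega> \<in> space M. \<delta> \<le> R T \<omega>} < e / 2"
    using small[OF \<delta>(1)] e by (intro order_tendstoD(2)) auto
  with eventually_gt_at_top[of 0]
  show "\<forall>\<^sub>F T in at_top. dist (prob {\<omega> \<in> space M. r \<le> N T \<omega>}) (H r) < e"
  proof eventually_elim
    case (elim T)
    have "{\<omega> \<in> space M. r \<le> N T \<omega>} \<subseteq> {\<omega> \<in> space M. r - \<delta> \<le> Z T \<omega>} \<union> {\<omega> \<in> space M. \<delta> \<le> R T \<omega>}"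
    proof safe
      fix \<omega> assume "r \<le> N T \<omega>" "\<not> \<delta> \<le> R T \<omega>"
      then show "r - \<delta> \<le> Z T \<omega>" using close[OF elim(1), of \<omega>] by linarith
    qed
    then have "prob {\<omega> \<in> space M. r \<le> N T \<omega>} \<le>
        prob ({\<omega> \<in> space M. r - \<delta> \<le> Z T \<omega>} \<union> {\<omega> \<in> space M. \<delta> \<le> R T \<omega>})"
      by (intro finite_measure_mono) auto
    also have "\<dots> \<le> prob {\<omega> \<in> space M. r - \<delta> \<le> Z T \<omega>} + prob {\<omega> \<in> space M. \<delta> \<le> R T \<omega>}"
      by (intro measure_Un_le) auto
    finally have upper: "prob {\<omega> \<in> space M. r \<le> N T \<omega>} < H (r - \<delta>) + e / 2"
      using tail[OF elim(1), of "r - \<delta>"] elim(2) \<delta> by linarith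
    have "{\<omega> \<in> space M. r + \<delta> \<le> Z T \<omega>} \<subseteq> {\<omega> \<in> space M. r \<le> N T \<omega>} \<union> {\<omega> \<in> space M. \<delta> \<le> R T \<omega>}"
    proof safe
      fix \<omega> assume "r + \<delta> \<le> Z T \<omega>" "\<not> \<delta> \<le> R T \<omega>"
      then show "r \<le> N T \<omega>" using close[OF elim(1), of \<omega>] by linarith
    qed
    then have "prob {\<omega> \<in> space M. r + \<delta> \<le> Z T \<omega>} \<le>
        prob ({\<omega> \<in> space M. r \<le> N T \<omega>} \<union> {\<omega> \<in> space M. \<delta> \<le> R T \<omega>})"
      by (intro finite_measure_mono) auto
    also have "\<dots> \<le> prob {\<omega> \<in> space M. r \<le> N T \<omega>} + prob {\<omega> \<in> space M. \<delta> \<le> R T \<omega>}"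
      by (intro measure_Un_le) auto
    finally have lower: "H (r + \<delta>) - e / 2 < prob {\<omega> \<in> space M. r \<le> N T \<omega>}"
      using tail[OF elim(1), of "r + \<delta>"] elim(2) \<delta> r by linarith
    have "dist (H (r - \<delta>)) (H r) < e / 2" "dist (H (r + \<delta>)) (H r) < e / 2"
      using Hd[of "r - \<delta>"] Hd[of "r + \<delta>"] \<delta> by (simp_all add: dist_real_def)
    then show ?case using upper lower unfolding dist_real_def by linarith
  qed
qed

lemma (in prob_space) prob_less_eq:
  fixes X :: "'a \<Rightarrow> real"
  assumes [measurable]: "X \<in> borel_measurable M"
  shows "prob {\<omega> \<in> space M. X \<omega> < x} = 1 - prob {\<omega> \<in> space M. x \<le> X \<omega>}"
proof -
  have "{\<omega> \<in> space M. X \<omega> < x} = space M - {\<omega> \<in> space M. x \<le> X \<omega>}" by auto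
  then show ?thesis by (simp add: prob_compl)
qed

context stable_ou_process
begin

lemma detection_statistic_measurable [measurable]:
  "detection_statistic M \<xi> T t \<in> borel_measurable M"
proof -
  let ?B = "matrix_inv (long_run_covariance M \<xi>)"
  have mean: "window_mean \<xi> T t \<in> borel_measurable M"
    unfolding window_mean_def[abs_def]
    by (intro borel_measurable_scaleR borel_measurable_const borel_measurable_path_integral
        \<xi>_measurable \<xi>_continuous)
  have "continuous_on UNIV (\<lambda>x. T * (x \<bullet> (?B *v x)))"
    by (intro continuous_intros bounded_linear.continuous_on[OF matrix_vector_mul_bounded_linear])
  then have "(\<lambda>x. T * (x \<bullet> (?B *v x))) \<in> borel_measurable borel"
    by (rule borel_measurable_continuous_onI)
  from measurable_compose[OF mean this] show ?thesis
    by (simp add: detection_statistic_def[abs_def])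
qed

lemma detection_statistic_eq:
  assumes T: "T > 0"
  shows "AE \<omega> in M. detection_statistic M \<xi> T t \<omega> =
    (norm (\<xi> t \<omega> - \<xi> (t - T) \<omega> - \<sigma> *\<^sub>R (W t \<omega> - W (t - T) \<omega>)) / (\<sigma> * sqrt T))\<^sup>2"
  using \<xi>_sde AE_space
proof eventually_elim
  fix \<omega> assume sde: "\<forall>s u. s \<le> u \<longrightarrow> \<xi> u \<omega> - \<xi> s \<omega> =
        integral {s..u} (\<lambda>r. A *v \<xi> r \<omega>) + \<sigma> *\<^sub>R (W u \<omega> - W s \<omega>)" and \<omega>: "\<omega> \<in> space M"
  let ?m = "window_mean \<xi> T t \<omega>"
  let ?v = "\<xi> t \<omega> - \<xi> (t - T) \<omega> - \<sigma> *\<^sub>R (W t \<omega> - W (t - T) \<omega>)"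
  have int: "(\<lambda>r. \<xi> r \<omega>) integrable_on {t - T..t}"
    by (intro integrable_continuous_interval continuous_on_subset[OF \<xi>_continuous[OF \<omega>]]) auto
  have "A *v integral {t - T..t} (\<lambda>r. \<xi> r \<omega>) = ?v"
    using integral_linear[OF int matrix_vector_mul_bounded_linear[of A]]
      sde[rule_format, of "t - T" t] T by (simp add: comp_def)
  then have Am: "A *v ?m = (1 / T) *\<^sub>R ?v"
    by (simp add: window_mean_def matrix_vector_mult_scaleR)
  have "?m \<bullet> (((1 / \<sigma>\<^sup>2) *\<^sub>R (transpose A ** A)) *v ?m) = (1 / \<sigma>\<^sup>2) * (?m \<bullet> (transpose A *v (A *v ?m)))"
    by (simp add: scaleR_matrix_vector_assoc[symmetric] matrix_vector_mul_assoc)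
  also have "?m \<bullet> (transpose A *v (A *v ?m)) = (norm (A *v ?m))\<^sup>2"
    by (metis dot_lmul_matrix power2_norm_eq_inner transpose_matrix_vector inner_commute)
  finally have "detection_statistic M \<xi> T t \<omega> = T * ((1 / \<sigma>\<^sup>2) * (norm (A *v ?m))\<^sup>2)"
    by (simp add: detection_statistic_def matrix_inv_long_run_covariance)
  also have "\<dots> = (norm ?v / (\<sigma> * sqrt T))\<^sup>2"
    unfolding Am using T by (simp add: power_mult_distrib power_divide power2_eq_square)
  finally show "detection_statistic M \<xi> T t \<omega> = (norm ?v / (\<sigma> * sqrt T))\<^sup>2" .
qed

text \<open>Markov's inequality for the squared norm. By stationarity both ends have the same second
  moment, so (a + b)^2 <= 2 a^2 + 2 b^2 gives the constant 4, against a denominator that grows like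
  T.\<close>

lemma boundary_term_tendsto_0:
  assumes \<delta>: "\<delta> > 0"
  shows "((\<lambda>T. prob {\<omega> \<in> space M. \<delta> \<le> norm (\<xi> t \<omega> - \<xi> (t - T) \<omega>) / (\<sigma> * sqrt T)}) \<longlongrightarrow> 0) at_top"
proof (rule tendsto_sandwich[where f = "\<lambda>_. 0"])
  let ?S = "expectation (\<lambda>\<omega>. (norm (\<xi> 0 \<omega>))\<^sup>2)"
  show "\<forall>\<^sub>F T in at_top. prob {\<omega> \<in> space M. \<delta> \<le> norm (\<xi> t \<omega> - \<xi> (t - T) \<omega>) / (\<sigma> * sqrt T)}
      \<le> 4 * ?S / (\<delta>\<^sup>2 * \<sigma>\<^sup>2 * T)"
    using eventually_gt_at_top[of 0]
  proof eventually_elim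
    case (elim T)
    let ?u = "\<lambda>\<omega>. 2 * (norm (\<xi> t \<omega>))\<^sup>2 + 2 * (norm (\<xi> (t - T) \<omega>))\<^sup>2"
    let ?c = "\<delta>\<^sup>2 * \<sigma>\<^sup>2 * T"
    have c: "?c > 0" using \<delta> \<sigma>_pos elim by simp
    have sub: "{\<omega> \<in> space M. \<delta> \<le> norm (\<xi> t \<omega> - \<xi> (t - T) \<omega>) / (\<sigma> * sqrt T)} \<subseteq> {\<omega> \<in> space M. ?c \<le> ?u \<omega>}"
    proof safe
      fix \<omega> assume "\<delta> \<le> norm (\<xi> t \<omega> - \<xi> (t - T) \<omega>) / (\<sigma> * sqrt T)"
      then have "\<delta> * (\<sigma> * sqrt T) \<le> norm (\<xi> t \<omega> - \<xi> (t - T) \<omega>)"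
        using \<sigma>_pos elim by (simp add: le_divide_eq)
      also have "\<dots> \<le> norm (\<xi> t \<omega>) + norm (\<xi> (t - T) \<omega>)" by (rule norm_triangle_ineq4)
      finally have "(\<delta> * (\<sigma> * sqrt T))\<^sup>2 \<le> (norm (\<xi> t \<omega>) + norm (\<xi> (t - T) \<omega>))\<^sup>2"
        using \<delta> \<sigma>_pos elim by (intro power_mono) auto
      also have "\<dots> \<le> ?u \<omega>"
        using sum_squares_bound[of "norm (\<xi> t \<omega>)" "norm (\<xi> (t - T) \<omega>)"] by (simp add: power2_sum)
      finally show "?c \<le> ?u \<omega>" using elim by (simp add: power_mult_distrib mult.assoc)
    qed
    have "prob {\<omega> \<in> space M. \<delta> \<le> norm (\<xi> t \<omega> - \<xi> (t - T) \<omega>) / (\<sigma> * sqrt T)} \<le> prob {\<omega> \<in> space M. ?c \<le> ?u \<omega>}"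
      by (intro finite_measure_mono sub) measurable
    also have "\<dots> \<le> expectation ?u / ?c"
      using c \<xi>_norm_square_integrable by (intro integral_Markov_inequality_measure[where A = "{}"]) auto
    also have "expectation ?u = 4 * ?S"
      using \<xi>_norm_square_integrable \<xi>_norm_square_expectation[of t] \<xi>_norm_square_expectation[of "t - T"] by simp
    finally show ?case .
  qed
  show "((\<lambda>T. 4 * ?S / (\<delta>\<^sup>2 * \<sigma>\<^sup>2 * T)) \<longlongrightarrow> 0) at_top"
    using \<delta> \<sigma>_pos by (intro real_tendsto_divide_at_top[OF tendsto_const]
        filterlim_tendsto_pos_mult_at_top[OF tendsto_const _ filterlim_ident]) simp
qed (auto simp: measure_nonneg)

lemma increment_tail:
  assumes n: "CARD('n) = 2" and T: "T > 0" and x: "x \<ge> 0"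
  shows "prob {\<omega> \<in> space M. x \<le> norm (W t \<omega> - W (t - T) \<omega>) / sqrt T} = exp (- x\<^sup>2 / 2)"
proof -
  interpret N: isotropic_normal_vector M "\<lambda>\<omega>. W t \<omega> - W (t - T) \<omega>" "sqrt T"
    using increment_normal[of "t - T" t] T by simp
  have "x \<le> norm (W t \<omega> - W (t - T) \<omega>) / sqrt T \<longleftrightarrow>
      x\<^sup>2 \<le> (norm (W t \<omega> - W (t - T) \<omega>) / sqrt T)\<^sup>2" for \<omega>
    using x T by (intro power_mono_iff[symmetric]) auto
  then have "prob {\<omega> \<in> space M. x \<le> norm (W t \<omega> - W (t - T) \<omega>) / sqrt T} =
      measure (distr M borel (\<lambda>\<omega>. (norm (W t \<omega> - W (t - T) \<omega>) / sqrt T)\<^sup>2)) {x\<^sup>2..}"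
    by (subst measure_distr) (auto intro!: arg_cong[where f = prob])
  then show ?thesis
    unfolding N.distr_norm_square n by (simp add: measure_chi_squared_2_tail)
qed

lemma detection_statistic_tail_tendsto:
  assumes n: "CARD('n) = 2" and d: "d > 0"
  shows "((\<lambda>T. prob {\<omega> \<in> space M. d \<le> detection_statistic M \<xi> T t \<omega>}) \<longlongrightarrow> exp (- d / 2)) at_top"
proof -
  \<comment> \<open>Square roots of the statistic and of its Brownian part are compared, since the
    reverse triangle inequality bounds their difference by the boundary term alone.\<close>
  define N where "N T \<omega> = norm (\<xi> t \<omega> - \<xi> (t - T) \<omega> - \<sigma> *\<^sub>R (W t \<omega> - W (t - T) \<omega>)) / (\<sigma> * sqrt T)" for T \<omega>
  define Z where "Z T \<omega> = norm (W t \<omega> - W (t - T) \<omega>) / sqrt T" for T \<omega>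
  define R where "R T \<omega> = norm (\<xi> t \<omega> - \<xi> (t - T) \<omega>) / (\<sigma> * sqrt T)" for T \<omega>
  have "((\<lambda>T. prob {\<omega> \<in> space M. sqrt d \<le> N T \<omega>}) \<longlongrightarrow> exp (- (sqrt d)\<^sup>2 / 2)) at_top"
  proof (rule tail_prob_tendsto_perturbed[where Z = Z and R = R and H = "\<lambda>x. exp (- x\<^sup>2 / 2)"])
    show "N T \<in> borel_measurable M" "Z T \<in> borel_measurable M" "R T \<in> borel_measurable M" for T
      unfolding N_def[abs_def] Z_def[abs_def] R_def[abs_def] by measurable
    show "\<bar>N T \<omega> - Z T \<omega>\<bar> \<le> R T \<omega>" if T: "T > 0" for T \<omega>
    proof -
      let ?a = "\<xi> t \<omega> - \<xi> (t - T) \<omega>" and ?b = "\<sigma> *\<^sub>R (W t \<omega> - W (t - T) \<omega>)"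
      have "Z T \<omega> = norm ?b / (\<sigma> * sqrt T)" using \<sigma>_pos by (simp add: Z_def)
      then have "N T \<omega> - Z T \<omega> = (norm (?a - ?b) - norm ?b) / (\<sigma> * sqrt T)"
        by (simp only: N_def diff_divide_distrib)
      moreover have "\<bar>\<sigma> * sqrt T\<bar> = \<sigma> * sqrt T" using \<sigma>_pos T by simp
      ultimately have "\<bar>N T \<omega> - Z T \<omega>\<bar> = \<bar>norm (?a - ?b) - norm ?b\<bar> / (\<sigma> * sqrt T)"
        by (simp only: abs_divide)
      also have "\<bar>norm (?a - ?b) - norm ?b\<bar> \<le> norm ?a"
        using norm_triangle_ineq3[of "?a - ?b" "- ?b"] by simp
      finally show ?thesis using \<sigma>_pos T by (simp add: R_def divide_right_mono)
    qed
    show "prob {\<omega> \<in> space M. x \<le> Z T \<omega>} = exp (- x\<^sup>2 / 2)" if "T > 0" "x > 0" for T x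
      unfolding Z_def using that by (intro increment_tail n) auto
    show "((\<lambda>T. prob {\<omega> \<in> space M. \<delta> \<le> R T \<omega>}) \<longlongrightarrow> 0) at_top" if "\<delta> > 0" for \<delta>
      unfolding R_def by (rule boundary_term_tendsto_0[OF that])
  qed (use d in \<open>auto intro!: continuous_intros\<close>)
  moreover have "\<forall>\<^sub>F T in at_top. prob {\<omega> \<in> space M. sqrt d \<le> N T \<omega>} =
      prob {\<omega> \<in> space M. d \<le> detection_statistic M \<xi> T t \<omega>}"
    using eventually_gt_at_top[of 0]
  proof eventually_elim
    case (elim T)
    show ?case
    proof (rule measure_eq_AE)
      show "AE \<omega> in M. \<omega> \<in> {\<omega> \<in> space M. sqrt d \<le> N T \<omega>} \<longleftrightarrow>
          \<omega> \<in> {\<omega> \<in> space M. d \<le> detection_statistic M \<xi> T t \<omega>}"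
        using detection_statistic_eq[OF elim, of t]
      proof eventually_elim
        case (elim \<omega>)
        have "N T \<omega> \<ge> 0" using \<sigma>_pos \<open>0 < T\<close> by (simp add: N_def)
        then have "sqrt d \<le> N T \<omega> \<longleftrightarrow> d \<le> (N T \<omega>)\<^sup>2"
          by (metis real_le_rsqrt real_sqrt_le_iff real_sqrt_unique)
        then show ?case using elim by (simp add: N_def)
      qed
    qed (unfold N_def, measurable)
  qed
  ultimately show ?thesis using d by (auto intro: Lim_transform_eventually)
qed

text \<open>Tails are controlled on closed half-lines {y..} with y > 0, whereas a distribution
  function measures {..x}. The gap is bridged by open half-lines: {..<x} from below, and {..<y} with
  y slightly above x from above.\<close>

lemma detection_statistic_weak_conv:
  assumes n: "CARD('n) = 2" and T: "filterlim T at_top sequentially"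
  shows "weak_conv_m (\<lambda>k. distr M borel (detection_statistic M \<xi> (T k) t)) (chi_squared 2)"
  unfolding weak_conv_m_def weak_conv_def
proof (intro allI impI)
  fix x :: real
  interpret C: prob_space "chi_squared 2" by (rule prob_space_chi_squared)
  let ?D = "\<lambda>k. detection_statistic M \<xi> (T k) t"
  have sets_chi: "sets (chi_squared 2) = sets borel" and space_chi: "space (chi_squared 2) = UNIV"
    by (simp_all add: chi_squared_def)
  have cdf_D: "cdf (distr M borel (?D k)) y = prob {\<omega> \<in> space M. ?D k \<omega> \<le> y}" for k y
    unfolding cdf_def by (subst measure_distr) (auto intro!: arg_cong[where f = prob])
  have lower_tail: "measure (chi_squared 2) {..<y} = 1 - exp (- y / 2)" if "y \<ge> 0" for y
    using C.prob_compl[of "{y..}"] measure_chi_squared_2_tail[OF that] sets_chi space_chi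
    by (simp add: Compl_eq_Diff_UNIV[symmetric])
  have tail_lim: "(\<lambda>k. prob {\<omega> \<in> space M. ?D k \<omega> < y}) \<longlonglongrightarrow> 1 - exp (- y / 2)" if "y > 0" for y
    unfolding prob_less_eq[OF detection_statistic_measurable]
    by (intro tendsto_intros filterlim_compose[OF detection_statistic_tail_tendsto[OF n that] T])
  have T_pos: "\<forall>\<^sub>F k in sequentially. T k > 0"
    using T by (rule filterlim_at_top_dense[THEN iffD1, rule_format])
  have upper: "\<forall>\<^sub>F k in sequentially. cdf (distr M borel (?D k)) x < a"
    if a: "y > max x 0" "1 - exp (- y / 2) < a" for y a
  proof -
    have "\<forall>\<^sub>F k in sequentially. prob {\<omega> \<in> space M. ?D k \<omega> < y} < a"
      using tail_lim[of y] a by (intro order_tendstoD(2)) auto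
    then show ?thesis
    proof eventually_elim
      case (elim k)
      have "prob {\<omega> \<in> space M. ?D k \<omega> \<le> x} \<le> prob {\<omega> \<in> space M. ?D k \<omega> < y}"
        using a by (intro finite_measure_mono) auto
      with elim show ?case by (simp add: cdf_D)
    qed
  qed
  have cdf_chi: "cdf (chi_squared 2) x = (if x \<ge> 0 then 1 - exp (- x / 2) else 0)"
  proof (cases "x \<ge> 0")
    case True
    have "cdf (chi_squared 2) x \<le> 1 - exp (- y / 2)" if "y > x" for y
    proof -
      have "C.prob {..x} \<le> C.prob {..<y}"
        using that by (intro C.finite_measure_mono) (auto simp: sets_chi)
      then show ?thesis using that True lower_tail[of y] by (simp add: cdf_def)
    qed
    then have "\<forall>\<^sub>F y in at_right x. cdf (chi_squared 2) x \<le> 1 - exp (- y / 2)"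
      by (auto simp: eventually_at_right_less eventually_at_filter intro!: always_eventually)
    moreover have "((\<lambda>y. 1 - exp (- y / 2)) \<longlongrightarrow> 1 - exp (- x / 2)) (at_right x)"
      by (intro tendsto_intros) auto
    ultimately have "cdf (chi_squared 2) x \<le> 1 - exp (- x / 2)"
      by (intro tendsto_lowerbound[of _ _ "at_right x"]) auto
    moreover have "1 - exp (- x / 2) \<le> cdf (chi_squared 2) x"
    proof -
      have "C.prob {..<x} \<le> C.prob {..x}"
        by (intro C.finite_measure_mono) (auto simp: sets_chi)
      then show ?thesis using lower_tail[OF True] by (simp add: cdf_def)
    qed
    ultimately show ?thesis using True by simp
  next
    case False
    then have "cdf (chi_squared 2) x \<le> 0"
    proof -
      have "C.prob {..x} \<le> C.prob {..<0}"
        using False by (intro C.finite_measure_mono) (auto simp: sets_chi)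
      then show ?thesis using lower_tail[of 0] by (simp add: cdf_def)
    qed
    moreover have "cdf (chi_squared 2) x \<ge> 0" by (simp add: cdf_def)
    ultimately show ?thesis using False by simp
  qed
  show "(\<lambda>k. cdf (distr M borel (?D k)) x) \<longlonglongrightarrow> cdf (chi_squared 2) x"
  proof (rule order_tendstoI)
    fix a assume a: "a < cdf (chi_squared 2) x"
    show "\<forall>\<^sub>F k in sequentially. a < cdf (distr M borel (?D k)) x"
    proof (cases "x > 0")
      case True
      have "\<forall>\<^sub>F k in sequentially. a < prob {\<omega> \<in> space M. ?D k \<omega> < x}"
        using tail_lim[OF True] a True by (intro order_tendstoD(1)) (auto simp: cdf_chi)
      then show ?thesis
      proof eventually_elim
        case (elim k)
        have "prob {\<omega> \<in> space M. ?D k \<omega> < x} \<le> prob {\<omega> \<in> space M. ?D k \<omega> \<le> x}"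
          by (intro finite_measure_mono) auto
        with elim show ?case by (simp add: cdf_D)
      qed
    next
      case False
      then have "a < 0" using a by (auto simp: cdf_chi split: if_splits)
      then show ?thesis by (intro always_eventually allI) (simp add: cdf_D order.strict_trans2)
    qed
  next
    fix a assume a: "cdf (chi_squared 2) x < a"
    show "\<forall>\<^sub>F k in sequentially. cdf (distr M borel (?D k)) x < a"
    proof (cases "x \<ge> 0")
      case True
      have "((\<lambda>y. 1 - exp (- y / 2)) \<longlongrightarrow> 1 - exp (- x / 2)) (at_right x)"
        by (intro tendsto_intros) auto
      then have "\<forall>\<^sub>F y in at_right x. 1 - exp (- y / 2) < a"
        using a True by (intro order_tendstoD(2)) (auto simp: cdf_chi)
      with eventually_at_right_less[of x] have "\<forall>\<^sub>F y in at_right x. x < y \<and> 1 - exp (- y / 2) < a"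
        by eventually_elim simp
      then obtain y where "x < y" "1 - exp (- y / 2) < a"
        using eventually_happens'[OF trivial_limit_at_right_real] by blast
      then show ?thesis using True by (intro upper[of y]) auto
    next
      case False
      then have a0: "a > 0" using a by (simp add: cdf_chi)
      \<comment> \<open>For negative x the tail limit says nothing; the statistic is almost surely a
        square once T k > 0, so the distribution function vanishes there.\<close>
      from T_pos show ?thesis
      proof eventually_elim
        case (elim k)
        have "prob {\<omega> \<in> space M. ?D k \<omega> \<le> x} = 0"
        proof -
          have "AE \<omega> in M. \<not> ?D k \<omega> \<le> x"
            using detection_statistic_eq[OF elim, of t]
          proof eventually_elim
            case (elim \<omega>)
            then have "?D k \<omega> \<ge> 0" by simp
            then show ?case using False by linarith
          qed
          then show ?thesis by (intro prob_eq_0_AE) simp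
        qed
        then show ?case using a0 by (simp add: cdf_D)
      qed
    qed
  qed
qed

end

text \<open>The weights \<open>diag (q, p)\<close> would cancel the off-diagonal terms exactly, but degenerate when
  \<open>p = 0\<close> or \<open>q = 0\<close>; a small shift \<open>\<epsilon>\<close> repairs this and leaves a cross term that the diagonal
  absorbs.\<close>
lemma A_perp_lyapunov_form:
  assumes a: "\<omega>\<^sub>f > 0" and b: "\<omega>\<^sub>v > 0" and "k\<^sub>P \<ge> 0" "k\<^sub>Q \<ge> 0"
  shows "\<exists>P \<kappa> K c. lyapunov_form (A_perp \<omega>\<^sub>f \<omega>\<^sub>v k\<^sub>P k\<^sub>Q) P \<kappa> K c"
proof -
  define p where "p = k\<^sub>P * \<omega>\<^sub>f"
  define q where "q = k\<^sub>Q * \<omega>\<^sub>v"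
  have pq: "p \<ge> 0" "q \<ge> 0" using assms by (auto simp: p_def q_def)
  \<comment> \<open>Chosen to give \<open>\<epsilon> * (p + q) \<le> \<omega>\<^sub>f *
    \<omega>\<^sub>v\<close>; the added 1 keeps the denominator positive when p = q = 0.\<close>
  define \<epsilon> where "\<epsilon> = \<omega>\<^sub>f * \<omega>\<^sub>v / (p + q + 1)"
  \<comment> \<open>With these weights the off-diagonal coefficient l p - m q reduces to \<epsilon>
    (p - q).\<close>
  define l where "l = q + \<epsilon>"
  define m where "m = p + \<epsilon>"
  define P :: "real ^ 2 ^ 2" where "P = vector [vector [l, 0], vector [0, m]]"
  \<comment> \<open>One half of the diagonal dissipation is reserved for the cross term; the other
    half leaves half of the smaller rate.\<close>
  define c where "c = min \<omega>\<^sub>f \<omega>\<^sub>v / 2"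
  have \<epsilon>: "\<epsilon> > 0" using a b pq by (simp add: \<epsilon>_def)
  have lm: "l > 0" "m > 0" using \<epsilon> pq by (auto simp: l_def m_def)
  \<comment> \<open>The discriminant condition for absorbing the cross term. One factor \<epsilon>
    (p + q) is bounded by the choice of \<epsilon>, and the other by l m, whose expansion contains
    it.\<close>
  have cross: "(\<epsilon> * (p - q))\<^sup>2 \<le> \<omega>\<^sub>f * \<omega>\<^sub>v * (l * m)"
  proof -
    have s: "\<epsilon> * (p + q) \<le> \<omega>\<^sub>f * \<omega>\<^sub>v"
    proof -
      have "\<epsilon> * (p + q) \<le> \<epsilon> * (p + q + 1)" using \<epsilon> by simp
      also have "\<dots> = \<omega>\<^sub>f * \<omega>\<^sub>v" using pq by (simp add: \<epsilon>_def)
      finally show ?thesis .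
    qed
    have "\<bar>p - q\<bar> \<le> p + q" using pq by simp
    then have "(\<epsilon> * (p - q))\<^sup>2 \<le> (\<epsilon> * (p + q))\<^sup>2"
      using \<epsilon> pq by (simp add: power_mult_distrib abs_le_square_iff[symmetric])
    also have "\<dots> \<le> \<omega>\<^sub>f * \<omega>\<^sub>v * (\<epsilon> * (p + q))"
      unfolding power2_eq_square using s \<epsilon> pq by (intro mult_right_mono) auto
    also have "\<dots> \<le> \<omega>\<^sub>f * \<omega>\<^sub>v * (l * m)"
      using a b \<epsilon> pq by (intro mult_left_mono) (auto simp: l_def m_def algebra_simps)
    finally show ?thesis .
  qed
  have form: "x \<bullet> (P *v x) = l * (x $ 1)\<^sup>2 + m * (x $ 2)\<^sup>2" for x
    by (simp add: P_def inner_vec_def matrix_vector_mult_def sum_2 power2_eq_square)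
  have A_eq: "A_perp \<omega>\<^sub>f \<omega>\<^sub>v k\<^sub>P k\<^sub>Q = vector [vector [- \<omega>\<^sub>f, p], vector [- q, - \<omega>\<^sub>v]]"
    by (simp add: A_perp_def p_def q_def)
  have nrm: "(norm x)\<^sup>2 = (x $ 1)\<^sup>2 + (x $ 2)\<^sup>2" for x :: "real ^ 2"
    unfolding power2_norm_eq_inner by (simp add: inner_vec_def sum_2 power2_eq_square)
  have "lyapunov_form (A_perp \<omega>\<^sub>f \<omega>\<^sub>v k\<^sub>P k\<^sub>Q) P (min l m) (max l m) c"
  proof
    show "transpose P = P"
      by (simp add: P_def transpose_def vec_eq_iff forall_2)
    show "min l m > 0" "max l m \<ge> 0" "c > 0" using lm a b by (auto simp: c_def)
    fix x :: "real ^ 2"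
    show "min l m * (norm x)\<^sup>2 \<le> x \<bullet> (P *v x)"
      unfolding form nrm distrib_left by (intro add_mono mult_right_mono) auto
    show "x \<bullet> (P *v x) \<le> max l m * (norm x)\<^sup>2"
      unfolding form nrm distrib_left by (intro add_mono mult_right_mono) auto
    let ?u = "\<omega>\<^sub>f * l * (x $ 1)\<^sup>2 / 2" and ?v = "\<omega>\<^sub>v * m * (x $ 2)\<^sup>2 / 2"
    have uv: "?u \<ge> 0" "?v \<ge> 0" using a b lm by auto
    \<comment> \<open>Squaring reduces this to the discriminant condition together with 4 u v <= (u
      + v)^2.\<close>
    have "\<epsilon> * (p - q) * (x $ 1 * x $ 2) \<le> ?u + ?v"
    proof (rule power2_le_imp_le)
      have "(\<epsilon> * (p - q) * (x $ 1 * x $ 2))\<^sup>2 \<le> \<omega>\<^sub>f * \<omega>\<^sub>v * (l * m) * (x $ 1 * x $ 2)\<^sup>2"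
        unfolding power_mult_distrib[of _ "x $ 1 * x $ 2"] by (intro mult_right_mono cross) simp
      also have "\<dots> = 4 * (?u * ?v)" by (simp add: power_mult_distrib)
      also have "\<dots> \<le> (?u + ?v)\<^sup>2"
        using sum_squares_bound[of ?u ?v] by (simp add: power2_sum)
      finally show "(\<epsilon> * (p - q) * (x $ 1 * x $ 2))\<^sup>2 \<le> (?u + ?v)\<^sup>2" .
    qed (use uv in simp)
    moreover have "x \<bullet> (P *v (A_perp \<omega>\<^sub>f \<omega>\<^sub>v k\<^sub>P k\<^sub>Q *v x)) =
        \<epsilon> * (p - q) * (x $ 1 * x $ 2) - \<omega>\<^sub>f * l * (x $ 1)\<^sup>2 - \<omega>\<^sub>v * m * (x $ 2)\<^sup>2"
      unfolding A_eq by (simp add: P_def inner_vec_def matrix_vector_mult_def sum_2 l_def m_def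
          power2_eq_square algebra_simps)
    moreover have "c * (l * (x $ 1)\<^sup>2) \<le> ?u" "c * (m * (x $ 2)\<^sup>2) \<le> ?v"
    proof -
      have "c * (l * (x $ 1)\<^sup>2) \<le> \<omega>\<^sub>f / 2 * (l * (x $ 1)\<^sup>2)" "c * (m * (x $ 2)\<^sup>2) \<le> \<omega>\<^sub>v / 2 * (m * (x $ 2)\<^sup>2)"
        using lm by (auto intro!: mult_right_mono simp: c_def)
      then show "c * (l * (x $ 1)\<^sup>2) \<le> ?u" "c * (m * (x $ 2)\<^sup>2) \<le> ?v" by simp_all
    qed
    ultimately show "x \<bullet> (P *v (A_perp \<omega>\<^sub>f \<omega>\<^sub>v k\<^sub>P k\<^sub>Q *v x)) \<le> - c * (x \<bullet> (P *v x))"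
      unfolding form by (simp add: distrib_left)
  qed
  then show ?thesis by blast
qed

theorem theorem3p7:
  fixes \<omega>\<^sub>f \<omega>\<^sub>v k\<^sub>P k\<^sub>Q \<sigma> \<alpha> t :: real
    and M :: "'a measure" and F :: "real \<Rightarrow> 'a measure"
    and W \<xi> :: "real \<Rightarrow> 'a \<Rightarrow> real ^ 2"
  assumes "\<omega>\<^sub>f > 0" and "\<omega>\<^sub>v > 0" and "k\<^sub>P \<ge> 0" and "k\<^sub>Q \<ge> 0" and "\<sigma> > 0"
    and "stationary_ou_process M F W (A_perp \<omega>\<^sub>f \<omega>\<^sub>v k\<^sub>P k\<^sub>Q) \<sigma> \<xi>"
    and "0 < \<alpha>" and "\<alpha> < 1"
  shows "(\<forall>T :: nat \<Rightarrow> real. filterlim T at_top sequentially \<longrightarrow>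
             weak_conv_m (\<lambda>n. distr M borel (detection_statistic M \<xi> (T n) t)) (chi_squared 2))
       \<and> (\<forall>d\<ge>0. measure (chi_squared 2) {d..} = exp (- d / 2))
       \<and> (\<exists>!d. measure (chi_squared 2) {d..} = \<alpha>)
       \<and> detection_threshold \<alpha> = - 2 * ln \<alpha>
       \<and> ((\<lambda>T. measure M {\<omega> \<in> space M. detection_statistic M \<xi> T t \<omega> \<ge> detection_threshold \<alpha>})
            \<longlongrightarrow> \<alpha>) at_top
       \<and> \<bar>detection_threshold (10 / 100) - 4605 / 1000\<bar> < 5 / 10000
       \<and> \<bar>detection_threshold (5 / 100) - 5991 / 1000\<bar> < 5 / 10000
       \<and> \<bar>detection_threshold (1 / 100) - 9210 / 1000\<bar> < 5 / 10000"
proof -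
  obtain P \<kappa> K c where "lyapunov_form (A_perp \<omega>\<^sub>f \<omega>\<^sub>v k\<^sub>P k\<^sub>Q) P \<kappa> K c"
    using A_perp_lyapunov_form[OF assms(1-4)] by blast
  then interpret stable_ou_process M F W "A_perp \<omega>\<^sub>f \<omega>\<^sub>v k\<^sub>P k\<^sub>Q" \<sigma> \<xi> P \<kappa> K c
    using assms by (simp add: stable_ou_process_def stable_ou_process_axioms_def)
  note threshold = detection_threshold_eq[OF assms(7,8)]
  \<comment> \<open>The tail limit is available for d > 0, which \<alpha> < 1 guarantees at d = - 2
    ln \<alpha>.\<close>
  have "((\<lambda>T. prob {\<omega> \<in> space M. - 2 * ln \<alpha> \<le> detection_statistic M \<xi> T t \<omega>}) \<longlongrightarrow> exp (- (- 2 * ln \<alpha>) / 2)) at_top"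
    using assms(7,8) by (intro detection_statistic_tail_tendsto) simp_all
  then have "((\<lambda>T. prob {\<omega> \<in> space M. detection_statistic M \<xi> T t \<omega> \<ge> detection_threshold \<alpha>}) \<longlongrightarrow> \<alpha>) at_top"
    unfolding threshold using assms(7) by simp
  then show ?thesis
    using detection_statistic_weak_conv[of _ t] measure_chi_squared_2_tail threshold
      chi_squared_2_tail_eq_iff[OF assms(7,8)] detection_threshold_10 detection_threshold_5
      detection_threshold_1
    by auto
qed

end
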